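(* Let $\mathcal{F}_{st}$ be the family of configurations of graphs with two distinguished distinct nodes $s$ (source) and $t$ (sink) and a natural number capacity $c(e)$ on each edge $e$. Let $\mathrm{MF}$ be the following problem over $\mathcal{F}_{st}$: each node $v$ additionally holds in its state an integer $f(v,u)$ for every neighbor $u$, and the predicate is true if and only if $f$ is a maximum flow from $s$ to $t$. Let $f_{\max}$ denote the maximal flow amount over all edges, $n$ the number of nodes and $\alpha$ the arboricity of the underlying graph. Let $\log f_{\max}\in\Omega(\log n)$. Then there exists a constant $c>1$ such that for every $1\le r\le\min\{\alpha/c,\sqrt[4]{f_{\max}}\}$, the verification complexity of $(\mathcal{F}_{st},\mathrm{MF})$ in the $\mathrm{MCAST}(r)$ model is $\Theta\left(\frac{\alpha}{r}\log f_{\max}\right)$.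
   Context: A configuration $G_s$ consists of a finite connected undirected graph $G=(V,E)$ and a state for each node $v$; the state contains all local input, including a unique identifier (polynomially bounded in $n$), the capacities of incident edges (consistently at both endpoints; capacity $0$ is allowed), and whether $v$ is the source or the sink. The edges incident to $v$ are numbered by ports $1,\dots,d(v)$, where $d(v)$ is the degree of $v$. Flow: $f(v,u)$ is the amount of flow from $v$ to $u$ (negative values mean flow from $u$ to $v$). $f$ is a legal flow iff (i) anti-symmetry: $f(v,u)=-f(u,v)$ for every edge $(v,u)$; (ii) $|f(v,u)|\le c(v,u)$ for every edge $(v,u)$; (iii) $\sum_u f(v,u)=0$ for every $v\ne s,t$. A maximum flow is a legal flow of maximum value (net flow out of $s$). Let $\mathcal{F}$ be a family of configurations and $\mathcal{P}$ a boolean predicate on $\mathcal{F}$; $G_s$ is legal if $\mathcal{P}(G_s)$ is true. A proof-labeling scheme (PLS) for $(\mathcal{F},\mathcal{P})$ is a pair (prover, verifier). Given a legal $G_s$, the prover assigns each node $v$ a label (a bit string, of any length). The verifier is a distributed one-round algorithm: each node, as a function of its state and label, sends a message (bit string) on each port, then, as a function of its state, its label and the messages received on each of its ports, outputs True or False. A configuration with labels is accepted if all nodes output True, and otherwise rejected. Requirements: every legal $G_s$ with the prover's labels is accepted; every illegal $G_s\in\mathcal{F}$ is rejected for every label assignment. $\mathrm{MCAST}(r)$ model: each node partitions its neighbors into at most $r$ groups and sends the same message to all neighbors of a group (so at most $r$ distinct messages, an empty message counting as a message). The arboricity $\alpha(G)$ is the minimum number of acyclic edge subsets covering $E$. The verification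 complexity of a PLS is the maximal length of a message sent by the verifier under the prover's labels in legal configurations; that of a problem is the minimum over all PLSs for it in the given model. Here it is regarded as a function of $n,\alpha,f_{\max},r$: worst case over legal configurations whose graph has $n$ nodes and arboricity $\alpha$, and whose flow on every edge is at most $f_{\max}$ in absolute value (the scheme may depend on these parameters). The constants (including $c$) may depend only on the constant implied in $\log f_{\max}\in\Omega(\log n)$ and on the exponent of the polynomial bound on identifiers; the lower bound is for all sufficiently large $n$. *)

theory Defs
  imports Complex_Main "HOL-Library.Extended_Real"
begin

section \<open>Configurations\<close>

type_synonym bits = "bool list"

text \<open>
  The names of the nodes (natural numbers) are not visible to the nodes themselves; a node only sees
  its state. The list \<open>ports G v\<close> enumerates the neighbors of \<open>v\<close> in port order, with the ports
  counted from \<open>0\<close> rather than from \<open>1\<close>.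
\<close>

record 's configuration =
  nodes :: "nat set"
  edges :: "nat set set"
  ports :: "nat \<Rightarrow> nat list"
  state :: "nat \<Rightarrow> 's"

definition neighbors :: "'s configuration \<Rightarrow> nat \<Rightarrow> nat set" where
  "neighbors G v = {u. {v, u} \<in> edges G}"

definition degree :: "'s configuration \<Rightarrow> nat \<Rightarrow> nat" where
  "degree G v = length (ports G v)"

definition port_of :: "'s configuration \<Rightarrow> nat \<Rightarrow> nat \<Rightarrow> nat" where
  "port_of G v u = (THE p. p < degree G v \<and> ports G v ! p = u)"

definition connected_graph :: "'s configuration \<Rightarrow> bool" where
  "connected_graph G \<longleftrightarrow>
     (\<forall>u\<in>nodes G. \<forall>v\<in>nodes G. (u, v) \<in> {(x, y). {x, y} \<in> edges G}\<^sup>*)"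

definition valid_configuration :: "'s configuration \<Rightarrow> bool" where
  "valid_configuration G \<longleftrightarrow>
     finite (nodes G) \<and> nodes G \<noteq> {} \<and>
     (\<forall>e\<in>edges G. e \<subseteq> nodes G \<and> card e = 2) \<and>
     connected_graph G \<and>
     (\<forall>v\<in>nodes G. distinct (ports G v) \<and> set (ports G v) = neighbors G v)"

definition acyclic_edges :: "nat set set \<Rightarrow> bool" where
  "acyclic_edges F \<longleftrightarrow>
     \<not> (\<exists>p. length p \<ge> 3 \<and> distinct p \<and>
          (\<forall>i<length p. {p ! i, p ! (Suc i mod length p)} \<in> F))"

definition arboricity :: "'s configuration \<Rightarrow> nat" where
  "arboricity G =
     (LEAST k. \<exists>F. (\<forall>i<k. F i \<subseteq> edges G \<and> acyclic_edges (F i)) \<and> edges G = (\<Union>i<k. F i))"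


section \<open>Proof-labeling schemes\<close>

text \<open>
  The verifier of a scheme is the pair \<open>send\<close>, \<open>decide\<close>: \<open>send A st l p\<close> is the message put on
  port \<open>p\<close> by a node with state \<open>st\<close> and label \<open>l\<close>; \<open>decide A st l ms\<close> is the output of such a
  node when \<open>ms ! p\<close> is the message received on port \<open>p\<close>.
\<close>

record 's pls =
  prover :: "'s configuration \<Rightarrow> nat \<Rightarrow> bits"
  send :: "'s \<Rightarrow> bits \<Rightarrow> nat \<Rightarrow> bits"
  decide :: "'s \<Rightarrow> bits \<Rightarrow> bits list \<Rightarrow> bool"

definition message ::
    "'s pls \<Rightarrow> 's configuration \<Rightarrow> (nat \<Rightarrow> bits) \<Rightarrow> nat \<Rightarrow> nat \<Rightarrow> bits" where
  "message A G l v u = send A (state G v) (l v) (port_of G v u)"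

definition accepted :: "'s pls \<Rightarrow> 's configuration \<Rightarrow> (nat \<Rightarrow> bits) \<Rightarrow> bool" where
  "accepted A G l \<longleftrightarrow>
     (\<forall>v\<in>nodes G. decide A (state G v) (l v) (map (\<lambda>u. message A G l u v) (ports G v)))"

definition is_pls ::
    "'s configuration set \<Rightarrow> ('s configuration \<Rightarrow> bool) \<Rightarrow> 's pls \<Rightarrow> bool" where
  "is_pls \<F> P A \<longleftrightarrow>
     (\<forall>G\<in>\<F>. P G \<longrightarrow> accepted A G (prover A G)) \<and>
     (\<forall>G\<in>\<F>. \<not> P G \<longrightarrow> (\<forall>l. \<not> accepted A G l))"

text \<open>
  Grouping the neighbors of a node by the message they are sent shows that a partition into at most
  \<open>r\<close> groups exists iff at most \<open>r\<close> distinct messages are sent. This has to hold for every label, since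
  the labels need not come from the prover.
\<close>

definition in_MCAST :: "nat \<Rightarrow> 's configuration set \<Rightarrow> 's pls \<Rightarrow> bool" where
  "in_MCAST r \<F> A \<longleftrightarrow>
     (\<forall>G\<in>\<F>. \<forall>v\<in>nodes G. \<forall>l. card (send A (state G v) l ` {..<degree G v}) \<le> r)"

text \<open>
  The complexity is measured on a subclass \<open>\<C>\<close> of the family (fixing the values of the parameters),
  whereas a scheme has to be correct, and to obey the model, on the whole family. Values are in
  \<^typ>\<open>enat\<close>: the messages of a scheme may have unbounded length on \<open>\<C>\<close>, and an infimum over the
  empty set of schemes is \<open>\<infinity>\<close>. A nonempty infimum in \<^typ>\<open>enat\<close> is a minimum.
\<close>

definition scheme_complexity ::
    "'s configuration set \<Rightarrow> ('s configuration \<Rightarrow> bool) \<Rightarrow> 's pls \<Rightarrow> enat" where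
  "scheme_complexity \<C> P A =
     Sup {enat (length (message A G (prover A G) v u)) | G v u.
            G \<in> \<C> \<and> P G \<and> v \<in> nodes G \<and> u \<in> neighbors G v}"

definition verification_complexity_MCAST ::
    "nat \<Rightarrow> 's configuration set \<Rightarrow> ('s configuration \<Rightarrow> bool) \<Rightarrow> 's configuration set \<Rightarrow> enat" where
  "verification_complexity_MCAST r \<F> P \<C> =
     (INF A \<in> {A. is_pls \<F> P A \<and> in_MCAST r \<F> A}. scheme_complexity \<C> P A)"


section \<open>Maximum flow\<close>

text \<open>The lists \<open>caps\<close> and \<open>flows\<close> are indexed by the ports of the node.\<close>

record flow_state =
  ident :: nat
  is_source :: bool
  is_sink :: bool
  caps :: "nat list"
  flows :: "int list"

definition capacity :: "flow_state configuration \<Rightarrow> nat \<Rightarrow> nat \<Rightarrow> nat" where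
  "capacity G v u = caps (state G v) ! port_of G v u"

definition held_flow :: "flow_state configuration \<Rightarrow> nat \<Rightarrow> nat \<Rightarrow> int" where
  "held_flow G v u = flows (state G v) ! port_of G v u"

text \<open>The family of the problem; identifiers are at most \<open>n ^ k\<close>, where \<open>n\<close> is the number of nodes.\<close>

definition F_st :: "nat \<Rightarrow> flow_state configuration set" where
  "F_st k = {G. valid_configuration G \<and>
     inj_on (\<lambda>v. ident (state G v)) (nodes G) \<and>
     (\<forall>v\<in>nodes G. ident (state G v) \<le> card (nodes G) ^ k) \<and>
     (\<forall>v\<in>nodes G. length (caps (state G v)) = degree G v \<and>
                   length (flows (state G v)) = degree G v) \<and>
     (\<forall>v\<in>nodes G. \<forall>u\<in>neighbors G v. capacity G v u = capacity G u v) \<and>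
     (\<exists>s\<in>nodes G. \<exists>t\<in>nodes G. s \<noteq> t \<and>
        (\<forall>v\<in>nodes G. (is_source (state G v) \<longleftrightarrow> v = s) \<and> (is_sink (state G v) \<longleftrightarrow> v = t)))}"

definition legal_flow :: "flow_state configuration \<Rightarrow> (nat \<Rightarrow> nat \<Rightarrow> real) \<Rightarrow> bool" where
  "legal_flow G f \<longleftrightarrow>
     (\<forall>v\<in>nodes G. \<forall>u\<in>neighbors G v. f v u = - f u v) \<and>
     (\<forall>v\<in>nodes G. \<forall>u\<in>neighbors G v. \<bar>f v u\<bar> \<le> real (capacity G v u)) \<and>
     (\<forall>v\<in>nodes G. \<not> is_source (state G v) \<and> \<not> is_sink (state G v) \<longrightarrow>
        (\<Sum>u\<in>neighbors G v. f v u) = 0)"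

definition source_node :: "flow_state configuration \<Rightarrow> nat" where
  "source_node G = (THE s. s \<in> nodes G \<and> is_source (state G s))"

definition flow_value :: "flow_state configuration \<Rightarrow> (nat \<Rightarrow> nat \<Rightarrow> real) \<Rightarrow> real" where
  "flow_value G f = (\<Sum>u\<in>neighbors G (source_node G). f (source_node G) u)"

definition maximum_flow :: "flow_state configuration \<Rightarrow> (nat \<Rightarrow> nat \<Rightarrow> real) \<Rightarrow> bool" where
  "maximum_flow G f \<longleftrightarrow>
     legal_flow G f \<and> (\<forall>g. legal_flow G g \<longrightarrow> flow_value G g \<le> flow_value G f)"

definition MF :: "flow_state configuration \<Rightarrow> bool" where
  "MF G \<longleftrightarrow> maximum_flow G (\<lambda>v u. real_of_int (held_flow G v u))"

definition F_st_class :: "nat \<Rightarrow> nat \<Rightarrow> nat \<Rightarrow> nat \<Rightarrow> flow_state configuration set" where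
  "F_st_class k n \<alpha> fmax =
     {G \<in> F_st k. card (nodes G) = n \<and> arboricity G = \<alpha> \<and>
        (\<forall>v\<in>nodes G. \<forall>u\<in>neighbors G v. \<bar>held_flow G v u\<bar> \<le> int fmax)}"

definition MF_complexity :: "nat \<Rightarrow> nat \<Rightarrow> nat \<Rightarrow> nat \<Rightarrow> nat \<Rightarrow> enat" where
  "MF_complexity k n \<alpha> fmax r =
     verification_complexity_MCAST r (F_st k) MF (F_st_class k n \<alpha> fmax)"

end

theory Submission
  imports Defs "HOL-Library.FuncSet" "HOL-Library.Countable"
begin

text \<open>
  Upper bound: a flow is maximum iff some cut is saturated, so it suffices that every node knows the
  side of its neighbors and that the two ends of every edge agree on the flow. A cover by \<open>\<alpha>\<close>
  forests orients the edges with at most \<open>\<alpha>\<close> edges leaving each node; a node distributes these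
  over \<open>r\<close> groups by the index of the forest and sends to each group the list of identifiers
  and flows of its at most \<open>\<lceil>\<alpha> / r\<rceil>\<close> edges in that group.

  Lower bound: a graph of arboricity \<open>\<alpha>\<close> may contain a complete bipartite graph with
  \<open>m = \<Theta>(\<alpha>)\<close> nodes on each side and almost no other edges across the cut given by one side. It
  carries \<open>(f\<^sub>m\<^sub>a\<^sub>x / 2) ^ ((m - 1)\<^sup>2)\<close> circulations. With messages of length \<open>M\<close>, all messages
  across the cut are determined by about \<open>2 m r M\<close> bits together with \<open>2 m\<^sup>2 log r\<close> bits for the
  choice of the groups, and the latter use at most half of the entropy if \<open>r ^ 4 \<le> f\<^sub>m\<^sub>a\<^sub>x\<close>.
  If \<open>M\<close> is too small, two circulations induce the same messages and can be crossed over.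
\<close>

section \<open>Arboricity and orientations\<close>

text \<open>What costs bits is the agreement of both ends of an edge on its flow, not optimality: a
  saturated cut needs one bit per message. Accordingly all configurations of the lower bound have
  flow value 0, since source and sink lie outside the complete bipartite graph and meet only edges
  of capacity 0; a crossed configuration is illegal merely because anti-symmetry fails. The obstacle
  in the upper bound is that a node does not know the identifiers behind its ports, and the label
  naming them may lie. So each message carries the identifier of its sender, against which such
  claims are checked, and a node that lists no flow for a port insists on finding itself in the list
  received there. Hence every edge is compared at least once. The lower bound has to work for every
  pair \<open>n\<close>, \<alpha> that occurs. If the bipartite graph with \<open>m\<close> =
  \<alpha> does not fit into \<open>n\<close> nodes, \<open>m\<close> is about \<open>n / 2\<close>.
  In either case the prescribed arboricity is reached by adding edges one by one, and the choice of
  these edges keeps the number of nodes at the cut below \<open>2 * m + 3\<close>.\<close>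

definition edge_arboricity :: "nat set set \<Rightarrow> nat" where
  "edge_arboricity E =
     (LEAST k. \<exists>F. (\<forall>i<k. F i \<subseteq> E \<and> acyclic_edges (F i)) \<and> E = (\<Union>i<k. F i))"

lemma arboricity_eq_edge_arboricity: "arboricity G = edge_arboricity (edges G)"
  by (simp add: arboricity_def edge_arboricity_def)

lemma acyclic_edges_subset: "acyclic_edges F \<Longrightarrow> F' \<subseteq> F \<Longrightarrow> acyclic_edges F'"
  unfolding acyclic_edges_def by blast

text \<open>Three consecutive edges of a cycle have no common node: the first two share only
  \<open>p ! 1\<close>, which the third one misses.\<close>

lemma acyclic_edges_star:
  assumes "\<And>e. e \<in> F \<Longrightarrow> v \<in> e"
  shows "acyclic_edges F"
  unfolding acyclic_edges_def
proof
  assume "\<exists>p. length p \<ge> 3 \<and> distinct p \<and> (\<forall>i<length p. {p ! i, p ! (Suc i mod length p)} \<in> F)"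
  then obtain p where p: "length p \<ge> 3" "distinct p"
    and e: "\<And>i. i < length p \<Longrightarrow> {p ! i, p ! (Suc i mod length p)} \<in> F" by blast
  have "0 < length p" "1 < length p" "2 < length p" using p(1) by auto
  note e' = assms[OF e[OF this(1)]] assms[OF e[OF this(2)]] assms[OF e[OF this(3)]]
  have "v \<in> {p ! 0, p ! 1}" using e'(1) p(1) by simp
  moreover have "v \<in> {p ! 1, p ! 2}" using e'(2) p(1) by (simp add: numeral_2_eq_2)
  moreover have "p ! 0 \<noteq> p ! 2" using p by (subst nth_eq_iff_index_eq) auto
  ultimately have v: "v = p ! 1" by auto
  have "v \<in> {p ! 2, p ! (3 mod length p)}" using e'(3) p(1) by (simp add: numeral_3_eq_3)
  moreover have "p ! 1 \<noteq> p ! 2" using p by (subst nth_eq_iff_index_eq) auto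
  \<comment> \<open>In a triangle the third edge returns to index 0, in a longer cycle it goes on to
    index 3.\<close>
  moreover have "3 mod length p \<noteq> 1" "3 mod length p < length p"
    using p by (cases "length p = 3"; simp)+
  then have "p ! 1 \<noteq> p ! (3 mod length p)" using p by (subst nth_eq_iff_index_eq) auto
  ultimately show False using v by auto
qed

text \<open>Any cover will do, since acyclicity survives intersecting its members with
  \<open>E\<close>.\<close>

lemma edge_arboricity_le:
  assumes "\<And>i. i < k \<Longrightarrow> acyclic_edges (F i)" "E \<subseteq> (\<Union>i<k. F i)"
  shows "edge_arboricity E \<le> k"
  unfolding edge_arboricity_def
proof (rule Least_le, intro exI conjI)
  show "\<forall>i<k. F i \<inter> E \<subseteq> E \<and> acyclic_edges (F i \<inter> E)"
    using assms(1) acyclic_edges_subset by blast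
  show "E = (\<Union>i<k. F i \<inter> E)" using assms(2) by blast
qed

text \<open>Covering by single edges shows that the least number exists, so the minimum is
  attained.\<close>

lemma edge_arboricity_cover:
  assumes "finite E" "\<And>e. e \<in> E \<Longrightarrow> e \<noteq> {}"
  obtains F where "\<And>i. i < edge_arboricity E \<Longrightarrow> F i \<subseteq> E"
    "\<And>i. i < edge_arboricity E \<Longrightarrow> acyclic_edges (F i)" "E = (\<Union>i<edge_arboricity E. F i)"
proof -
  let ?P = "\<lambda>k. \<exists>F. (\<forall>i<k. F i \<subseteq> E \<and> acyclic_edges (F i)) \<and> E = (\<Union>i<k. F i)"
  obtain es where es: "set es = E" using assms(1) finite_list by blast
  have "?P (length es)"
  proof (intro exI conjI)
    show "\<forall>i<length es. {es ! i} \<subseteq> E \<and> acyclic_edges {es ! i}"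
    proof (intro allI impI conjI)
      fix i assume i: "i < length es"
      then show "{es ! i} \<subseteq> E" using es by auto
      obtain v where "v \<in> es ! i" using assms(2) es i by (metis all_not_in_conv nth_mem)
      then show "acyclic_edges {es ! i}" by (intro acyclic_edges_star[of _ v]) auto
    qed
    show "E = (\<Union>i<length es. {es ! i})" using es by (auto simp: set_conv_nth)
  qed
  then have "?P (edge_arboricity E)" unfolding edge_arboricity_def by (rule LeastI)
  then show ?thesis using that by blast
qed

lemma edge_arboricity_mono:
  assumes "finite E" "\<And>e. e \<in> E \<Longrightarrow> e \<noteq> {}" "E' \<subseteq> E"
  shows "edge_arboricity E' \<le> edge_arboricity E"
  by (rule edge_arboricity_cover[OF assms(1,2)]) (use assms(3) in \<open>auto intro!: edge_arboricity_le\<close>)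

lemma edge_arboricity_insert:
  assumes "finite E" "\<And>e'. e' \<in> E \<Longrightarrow> e' \<noteq> {}" "e \<noteq> {}"
  shows "edge_arboricity (insert e E) \<le> Suc (edge_arboricity E)"
proof -
  obtain F where F: "\<And>i. i < edge_arboricity E \<Longrightarrow> acyclic_edges (F i)"
    "E = (\<Union>i<edge_arboricity E. F i)"
    by (rule edge_arboricity_cover[OF assms(1,2)]) auto
  obtain v where "v \<in> e" using assms(3) by blast
  then have "acyclic_edges {e}" by (intro acyclic_edges_star[of _ v]) auto
  then have "acyclic_edges (if i < edge_arboricity E then F i else {e})" for i
    using F(1) by simp
  moreover have "insert e E \<subseteq> (\<Union>i<Suc (edge_arboricity E). if i < edge_arboricity E then F i else {e})"
    (is "_ \<subseteq> (\<Union>i<_. ?F i)")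
  proof
    fix x assume "x \<in> insert e E"
    then consider "x = e" | i where "i < edge_arboricity E" "x \<in> F i" using F(2) by blast
    then show "x \<in> (\<Union>i<Suc (edge_arboricity E). ?F i)"
    proof cases
      case 1
      then have "x \<in> ?F (edge_arboricity E)" by simp
      then show ?thesis by blast
    next
      case (2 i)
      then have "x \<in> ?F i" "i < Suc (edge_arboricity E)" by auto
      then show ?thesis by blast
    qed
  qed
  ultimately show ?thesis by (rule edge_arboricity_le)
qed

text \<open>Inserting an edge raises the arboricity by at most one, so every intermediate value occurs.\<close>

lemma edge_arboricity_intermediate:
  assumes "finite D" "finite E" "\<And>e. e \<in> E \<union> D \<Longrightarrow> e \<noteq> {}"
    and "edge_arboricity E \<le> a" "a \<le> edge_arboricity (E \<union> D)"
  shows "\<exists>D'\<subseteq>D. edge_arboricity (E \<union> D') = a"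
  using assms
proof (induction D rule: finite_induct)
  case empty
  then show ?case by auto
next
  case (insert e D)
  show ?case
  proof (cases "a \<le> edge_arboricity (E \<union> D)")
    case True
    then have "\<exists>D'\<subseteq>D. edge_arboricity (E \<union> D') = a" using insert by auto
    then show ?thesis by blast
  next
    case False
    have "edge_arboricity (insert e (E \<union> D)) \<le> Suc (edge_arboricity (E \<union> D))"
      using insert.prems insert.hyps by (intro edge_arboricity_insert) auto
    then have "edge_arboricity (E \<union> insert e D) = a" using False insert.prems by simp
    then show ?thesis by blast
  qed
qed

section \<open>Forests: leaves, tails of edges, number of edges\<close>

text \<open>An end of a longest path is a leaf: a further edge at it either prolongs the path or
  closes a cycle.\<close>

lemma acyclic_edges_leaf:
  assumes "finite F" "F \<noteq> {}" "\<And>e. e \<in> F \<Longrightarrow> card e = 2" "acyclic_edges F"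
  obtains v e where "e \<in> F" "v \<in> e" "\<And>e'. e' \<in> F \<Longrightarrow> v \<in> e' \<Longrightarrow> e' = e"
proof (rule ccontr)
  assume "\<not> thesis"
  with that have other: "\<exists>e'\<in>F. v \<in> e' \<and> e' \<noteq> e" if "e \<in> F" "v \<in> e" for e v
    using that by blast
  have fin: "finite (\<Union>F)"
    using assms(1,3) by (metis card.infinite finite_Union zero_neq_numeral)
  define P where "P p \<longleftrightarrow> distinct p \<and> length p \<ge> 2 \<and>
    (\<forall>i. Suc i < length p \<longrightarrow> {p ! i, p ! Suc i} \<in> F)" for p
  have len: "length p \<le> card (\<Union>F)" if "P p" for p
  proof -
    have "x \<in> \<Union>F" if "x \<in> set p" for x
    proof -
      obtain i where i: "i < length p" "x = p ! i" using \<open>x \<in> set p\<close> by (metis in_set_conv_nth)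
      show ?thesis
      proof (cases "Suc i < length p")
        case True
        then show ?thesis using i \<open>P p\<close> unfolding P_def by blast
      next
        case False
        then obtain j where "i = Suc j" using i \<open>P p\<close> unfolding P_def by (cases i) auto
        then show ?thesis using i \<open>P p\<close> unfolding P_def by blast
      qed
    qed
    then have "card (set p) \<le> card (\<Union>F)" using fin by (intro card_mono) auto
    then show ?thesis using \<open>P p\<close> by (simp add: P_def distinct_card)
  qed
  obtain a b where ab: "{a, b} \<in> F" "a \<noteq> b"
    using assms(2,3) by (metis card_2_iff ex_in_conv)
  have "P [a, b]" using ab by (simp add: P_def)
  then obtain p where p: "P p" and max: "\<And>q. P q \<Longrightarrow> length q \<le> length p"
    using ex_has_greatest_nat[of P _ length "Suc (card (\<Union>F))"] len by (metis le_imp_less_Suc)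
  then have p2: "distinct p" "length p \<ge> 2" and pe: "\<And>i. Suc i < length p \<Longrightarrow> {p ! i, p ! Suc i} \<in> F"
    by (auto simp: P_def)
  have "{p ! 0, p ! 1} \<in> F" using pe[of 0] p2 by simp
  then obtain e where e: "e \<in> F" "p ! 0 \<in> e" "e \<noteq> {p ! 0, p ! 1}" using other by blast
  then obtain w where w: "e = {p ! 0, w}" "w \<noteq> p ! 0"
    using assms(3)[OF e(1)] by (auto simp: card_2_iff)
  show False
  proof (cases "w \<in> set p")
    case False
    have "P (w # p)"
      unfolding P_def
    proof (intro conjI allI impI)
      fix i assume "Suc i < length (w # p)"
      then show "{(w # p) ! i, (w # p) ! Suc i} \<in> F"
        using pe e w by (cases i) (auto simp: insert_commute)
    qed (use False p2 in auto)
    from max[OF this] show False by simp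
  next
    case True
    then obtain i where i: "i < length p" "w = p ! i" by (auto simp: in_set_conv_nth)
    \<comment> \<open>The new edge differs from the first edge of the path, so the prefix that it
      closes has at least three nodes.\<close>
    have "i \<noteq> 0" "i \<noteq> 1" using w e i by (metis, metis)
    define q where "q = take (Suc i) p"
    have q: "length q = Suc i" "\<And>j. j \<le> i \<Longrightarrow> q ! j = p ! j" using i by (auto simp: q_def)
    have "\<forall>j<length q. {q ! j, q ! (Suc j mod length q)} \<in> F"
    proof (intro allI impI)
      fix j assume j: "j < length q"
      show "{q ! j, q ! (Suc j mod length q)} \<in> F"
      proof (cases "j = i")
        case True
        then show ?thesis using q e w i by (simp add: insert_commute)
      next
        case False
        then show ?thesis using q pe j i by simp
      qed
    qed
    moreover have "distinct q" "length q \<ge> 3" using p2 q \<open>i \<noteq> 0\<close> \<open>i \<noteq> 1\<close> by (auto simp: q_def)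
    ultimately show False using assms(4) unfolding acyclic_edges_def by blast
  qed
qed

text \<open>By induction on the edges: the edge at a leaf gets the leaf as its tail, and no other
  edge can claim that node.\<close>

lemma acyclic_edges_tail:
  assumes "finite F" "\<And>e. e \<in> F \<Longrightarrow> card e = 2" "acyclic_edges F"
  shows "\<exists>tail. inj_on tail F \<and> (\<forall>e\<in>F. tail e \<in> e)"
  using assms
proof (induction "card F" arbitrary: F)
  case 0
  then show ?case by auto
next
  case (Suc k)
  then have "F \<noteq> {}" by auto
  then obtain v e where v: "e \<in> F" "v \<in> e" "\<And>e'. e' \<in> F \<Longrightarrow> v \<in> e' \<Longrightarrow> e' = e"
    using acyclic_edges_leaf Suc.prems by metis
  have "\<exists>tail. inj_on tail (F - {e}) \<and> (\<forall>e'\<in>F - {e}. tail e' \<in> e')"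
    using Suc.hyps(2) Suc.prems v(1) acyclic_edges_subset[OF Suc.prems(3)]
    by (intro Suc.hyps(1)) auto
  then obtain tail where t: "inj_on tail (F - {e})" "\<forall>e'\<in>F - {e}. tail e' \<in> e'" by blast
  have "inj_on (tail(e := v)) (F - {e})" using t(1) by (simp add: inj_on_def)
  moreover have "v \<notin> tail ` (F - {e})" using t(2) v(3) by blast
  ultimately have "inj_on (tail(e := v)) (insert e (F - {e}))" unfolding inj_on_insert by simp
  then have "inj_on (tail(e := v)) F" using v(1) by (simp add: insert_absorb)
  moreover have "\<forall>e'\<in>F. (tail(e := v)) e' \<in> e'" using t(2) v(2) by simp
  ultimately show ?case by blast
qed

text \<open>Injectivity of the tails gives the bound directly; being one above the sharp value does
  no harm where it is used.\<close>

lemma acyclic_edges_card_le: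
  assumes "finite X" "\<And>e. e \<in> F \<Longrightarrow> card e = 2 \<and> e \<subseteq> X" "acyclic_edges F"
  shows "card F \<le> card X"
proof -
  have "F \<subseteq> Pow X" using assms(2) by blast
  then have "finite F" using assms(1) finite_subset by blast
  then have "\<exists>tail. inj_on tail F \<and> (\<forall>e\<in>F. tail e \<in> e)"
    using assms(2,3) by (intro acyclic_edges_tail) auto
  then obtain tail where t: "inj_on tail F" "\<forall>e\<in>F. tail e \<in> e" by blast
  moreover have "tail ` F \<subseteq> X" using t assms(2) by blast
  ultimately show ?thesis using assms(1) by (metis card_image card_mono)
qed

text \<open>
  The tails of the edges of a forest are distinct, so at a node every forest of the cover
  contributes at most one outgoing edge.
\<close>

lemma edge_arboricity_orientation:
  assumes "finite E" "\<And>e. e \<in> E \<Longrightarrow> card e = 2"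
  obtains tail idx where "\<And>e. e \<in> E \<Longrightarrow> tail e \<in> e" "\<And>e. e \<in> E \<Longrightarrow> idx e < edge_arboricity E"
    "\<And>v. inj_on idx {e \<in> E. tail e = v}"
proof -
  have "e \<noteq> {}" if "e \<in> E" for e using assms(2)[OF that] by auto
  then obtain F where F: "\<And>i. i < edge_arboricity E \<Longrightarrow> F i \<subseteq> E"
    "\<And>i. i < edge_arboricity E \<Longrightarrow> acyclic_edges (F i)" "E = (\<Union>i<edge_arboricity E. F i)"
    using edge_arboricity_cover[OF assms(1)] by metis
  have "\<exists>tl. inj_on tl (F i) \<and> (\<forall>e\<in>F i. tl e \<in> e)" if "i < edge_arboricity E" for i
    using F(1,2)[OF that] assms by (intro acyclic_edges_tail) (auto intro: finite_subset)
  then obtain tl where tl: "\<And>i. i < edge_arboricity E \<Longrightarrow> inj_on (tl i) (F i)"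
    "\<And>i e. i < edge_arboricity E \<Longrightarrow> e \<in> F i \<Longrightarrow> tl i e \<in> e" by metis
  have "\<forall>e\<in>E. \<exists>i. i < edge_arboricity E \<and> e \<in> F i" using F(3) by blast
  then obtain idx where idx: "\<And>e. e \<in> E \<Longrightarrow> idx e < edge_arboricity E \<and> e \<in> F (idx e)" by metis
  show ?thesis
  proof (rule that[of "\<lambda>e. tl (idx e) e" idx])
    show "inj_on idx {e \<in> E. tl (idx e) e = v}" for v
    proof (rule inj_onI)
      fix e e' assume *: "e \<in> {e \<in> E. tl (idx e) e = v}" "e' \<in> {e \<in> E. tl (idx e) e = v}" "idx e = idx e'"
      then have "tl (idx e) e = tl (idx e) e'" by simp
      then show "e = e'" using * idx tl(1) unfolding inj_on_def by (metis (no_types, lifting) mem_Collect_eq)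
    qed
  qed (use idx tl in auto)
qed

text \<open>\<open>X\<close> is a vertex cover, and the stars at its nodes are forests.\<close>

lemma edge_arboricity_le_card:
  assumes "finite X" "\<And>e. e \<in> E \<Longrightarrow> e \<inter> X \<noteq> {}"
  shows "edge_arboricity E \<le> card X"
proof -
  obtain h where h: "bij_betw h {..<card X} X" using ex_bij_betw_nat_finite[OF assms(1)] by (auto simp: atLeast0LessThan)
  show ?thesis
  proof (rule edge_arboricity_le)
    show "acyclic_edges {e. h i \<in> e}" for i by (rule acyclic_edges_star[of _ "h i"]) auto
    show "E \<subseteq> (\<Union>i<card X. {e. h i \<in> e})"
    proof
      fix e assume "e \<in> E"
      then obtain x where "x \<in> e" "x \<in> X" using assms(2) by blast
      then show "e \<in> (\<Union>i<card X. {e. h i \<in> e})" using h unfolding bij_betw_def by (auto dest: equalityD2[THEN subsetD])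
    qed
  qed
qed

section \<open>Complete graphs\<close>

definition complete_edges :: "nat set \<Rightarrow> nat set set" where
  "complete_edges X = {e. e \<subseteq> X \<and> card e = 2}"

lemma finite_complete_edges: "finite X \<Longrightarrow> finite (complete_edges X)"
  unfolding complete_edges_def by (rule finite_subset[of _ "Pow X"]) auto

lemma complete_edges_nonempty: "e \<in> complete_edges X \<Longrightarrow> e \<noteq> {}"
  by (auto simp: complete_edges_def)

text \<open>Counting edges gives at least \<open>m - 1/2\<close> forests, even with the crude bound
  of \<open>2 * m\<close> edges per forest; integrality supplies the rest.\<close>

lemma le_edge_arboricity_complete:
  assumes "finite X" "card X = 2 * m"
  shows "m \<le> edge_arboricity (complete_edges X)"
proof (cases "m = 0")
  case False
  let ?K = "complete_edges X" let ?a = "edge_arboricity ?K"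
  obtain F where F: "\<And>i. i < ?a \<Longrightarrow> F i \<subseteq> ?K"
    "\<And>i. i < ?a \<Longrightarrow> acyclic_edges (F i)" "?K = (\<Union>i<?a. F i)"
    using edge_arboricity_cover[OF finite_complete_edges[OF assms(1)]] complete_edges_nonempty by metis
  have "m * (2 * m - 1) = card ?K"
    using n_subsets[OF assms(1), of 2] assms(2) by (simp add: complete_edges_def choose_two mult.assoc)
  also have "\<dots> = card (\<Union>i\<in>{..<?a}. F i)" using F(3) by simp
  also have "\<dots> \<le> (\<Sum>i<?a. card (F i))" by (rule card_UN_le) simp
  also have "\<dots> \<le> (\<Sum>i<?a. 2 * m)"
  proof (rule sum_mono)
    fix i assume "i \<in> {..<?a}"
    then show "card (F i) \<le> 2 * m" 
      using acyclic_edges_card_le[OF assms(1), of "F i"] F(1,2)[of i] assms(2)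
      by (auto simp: complete_edges_def)
  qed
  finally have le: "m * (2 * m - 1) \<le> ?a * (2 * m)" by simp
  show ?thesis
  proof (rule ccontr)
    assume "\<not> m \<le> ?a"
    then have "?a * (2 * m) \<le> (m - 1) * (2 * m)" by (intro mult_right_mono) auto
    with le have "m * (2 * m - 1) \<le> m * (2 * (m - 1))" by (simp only: ac_simps)
    then show False using False by auto
  qed
qed simp

text \<open>A forest cover of the complete graph pulls back along a bijection of the nodes. This
  shows that an arboricity occurring on \<open>n\<close> nodes lies within the range of the
  intermediate value argument.\<close>

lemma edge_arboricity_le_complete:
  assumes "finite V" "\<And>e. e \<in> E \<Longrightarrow> e \<subseteq> V \<and> card e = 2"
  shows "edge_arboricity E \<le> edge_arboricity (complete_edges {..<card V})"
proof -
  let ?K = "complete_edges {..<card V}"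
  obtain h where h: "bij_betw h V {..<card V}" using ex_bij_betw_finite_nat[OF assms(1)] by (auto simp: atLeast0LessThan)
  obtain F where F: "\<And>i. i < edge_arboricity ?K \<Longrightarrow> acyclic_edges (F i)"
    "?K = (\<Union>i<edge_arboricity ?K. F i)"
    using edge_arboricity_cover[OF finite_complete_edges[of "{..<card V}"]] complete_edges_nonempty by (metis finite_lessThan)
  show ?thesis
  proof (rule edge_arboricity_le)
    fix i assume i: "i < edge_arboricity ?K"
    show "acyclic_edges {e. e \<subseteq> V \<and> h ` e \<in> F i}"
      unfolding acyclic_edges_def
    proof
      assume "\<exists>p. length p \<ge> 3 \<and> distinct p \<and>
        (\<forall>j<length p. {p ! j, p ! (Suc j mod length p)} \<in> {e. e \<subseteq> V \<and> h ` e \<in> F i})"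
      then obtain p where p: "length p \<ge> 3" "distinct p"
        and e: "\<forall>j<length p. {p ! j, p ! (Suc j mod length p)} \<subseteq> V \<and> {h (p ! j), h (p ! (Suc j mod length p))} \<in> F i"
        by (auto simp: image_insert)
      have "set p \<subseteq> V" using e by (auto simp: set_conv_nth)
      then have "distinct (map h p)" using p(2) h by (auto simp: distinct_map bij_betw_def inj_on_subset)
      moreover have "\<forall>j<length (map h p). {map h p ! j, map h p ! (Suc j mod length (map h p))} \<in> F i"
      proof (intro allI impI)
        fix j assume j: "j < length (map h p)"
        then have "Suc j mod length p < length p" by (intro mod_less_divisor) auto
        then show "{map h p ! j, map h p ! (Suc j mod length (map h p))} \<in> F i" using e j by simp
      qed
      ultimately show False using F(1)[OF i] p(1) unfolding acyclic_edges_def by (metis length_map)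
    qed
  next
    show "E \<subseteq> (\<Union>i<edge_arboricity ?K. {e. e \<subseteq> V \<and> h ` e \<in> F i})"
    proof
      fix e assume "e \<in> E"
      then have e: "e \<subseteq> V" "card e = 2" using assms(2) by auto
      then have "card (h ` e) = 2" using h by (metis bij_betw_def card_image inj_on_subset)
      then have "h ` e \<in> ?K" using e h by (auto simp: complete_edges_def bij_betw_def)
      then show "e \<in> (\<Union>i<edge_arboricity ?K. {e. e \<subseteq> V \<and> h ` e \<in> F i})" using F(2) e by auto
    qed
  qed
qed


section \<open>Maximum flows and saturated cuts\<close>

lemma F_st_nodes:
  assumes "G \<in> F_st k"
  shows "finite (nodes G)" "inj_on (\<lambda>v. ident (state G v)) (nodes G)"
    and "v \<in> nodes G \<Longrightarrow> ident (state G v) \<le> card (nodes G) ^ k"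
    and "v \<in> nodes G \<Longrightarrow> length (caps (state G v)) = degree G v"
    and "v \<in> nodes G \<Longrightarrow> length (flows (state G v)) = degree G v"
    and "v \<in> nodes G \<Longrightarrow> u \<in> neighbors G v \<Longrightarrow> capacity G v u = capacity G u v"
  using assms by (auto simp: F_st_def valid_configuration_def)

lemma F_st_edges:
  assumes "G \<in> F_st k"
  shows "finite (edges G)" "e \<in> edges G \<Longrightarrow> e \<subseteq> nodes G" "e \<in> edges G \<Longrightarrow> card e = 2"
proof -
  have *: "\<forall>e\<in>edges G. e \<subseteq> nodes G \<and> card e = 2" "finite (nodes G)"
    using assms by (auto simp: F_st_def valid_configuration_def)
  then have "edges G \<subseteq> Pow (nodes G)" by blast
  with *(2) show "finite (edges G)" using finite_subset by blast
  show "e \<in> edges G \<Longrightarrow> e \<subseteq> nodes G" "e \<in> edges G \<Longrightarrow> card e = 2" using * by auto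
qed

lemma F_st_neighbors:
  assumes "G \<in> F_st k"
  shows "neighbors G v \<subseteq> nodes G" "finite (neighbors G v)" "u \<in> neighbors G v \<Longrightarrow> v \<in> nodes G"
    and "u \<in> neighbors G v \<longleftrightarrow> v \<in> neighbors G u" "v \<notin> neighbors G v"
proof -
  show "neighbors G v \<subseteq> nodes G" "u \<in> neighbors G v \<Longrightarrow> v \<in> nodes G"
    using F_st_edges(2)[OF assms] by (auto simp: neighbors_def)
  then show "finite (neighbors G v)" using F_st_nodes(1)[OF assms] finite_subset by blast
  show "u \<in> neighbors G v \<longleftrightarrow> v \<in> neighbors G u" by (simp add: neighbors_def insert_commute)
  show "v \<notin> neighbors G v" using F_st_edges(3)[OF assms, of "{v}"] by (auto simp: neighbors_def)
qed

lemma F_st_ports: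
  assumes "G \<in> F_st k" "v \<in> nodes G"
  shows "distinct (ports G v)" "set (ports G v) = neighbors G v"
  using assms by (auto simp: F_st_def valid_configuration_def)

lemma F_st_source_sink:
  assumes "G \<in> F_st k"
  obtains s t where "s \<in> nodes G" "t \<in> nodes G" "s \<noteq> t"
    "\<And>v. v \<in> nodes G \<Longrightarrow> is_source (state G v) \<longleftrightarrow> v = s"
    "\<And>v. v \<in> nodes G \<Longrightarrow> is_sink (state G v) \<longleftrightarrow> v = t" "source_node G = s"
proof -
  obtain s t where st: "s \<in> nodes G" "t \<in> nodes G" "s \<noteq> t"
    "\<forall>v\<in>nodes G. (is_source (state G v) \<longleftrightarrow> v = s) \<and> (is_sink (state G v) \<longleftrightarrow> v = t)"
    using assms by (auto simp: F_st_def)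
  moreover from st have "source_node G = s" unfolding source_node_def by (intro the_equality) auto
  ultimately show ?thesis using that by blast
qed

lemma port_of_nth:
  assumes "distinct (ports G v)" "p < degree G v"
  shows "port_of G v (ports G v ! p) = p"
  unfolding port_of_def using assms by (intro the_equality) (auto simp: degree_def nth_eq_iff_index_eq)

lemma nth_port_of:
  assumes "distinct (ports G v)" "u \<in> set (ports G v)"
  shows "port_of G v u < degree G v" "ports G v ! port_of G v u = u"
proof -
  obtain p where "p < degree G v" "ports G v ! p = u"
    using assms(2) by (auto simp: in_set_conv_nth degree_def)
  then show "port_of G v u < degree G v" "ports G v ! port_of G v u = u"
    using port_of_nth[OF assms(1)] by auto
qed

lemma F_st_port_of:
  assumes "G \<in> F_st k" "u \<in> neighbors G v"
  shows "port_of G v u < degree G v" "ports G v ! port_of G v u = u"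
  using nth_port_of[of G v u] F_st_ports[of G k v] F_st_neighbors(3)[OF assms] assms by auto

section \<open>Cuts and optimality\<close>

text \<open>Add up the net outflow of all nodes of \<open>S\<close>: conservation leaves only the
  source, and anti-symmetry cancels the edges inside \<open>S\<close>.\<close>

lemma cut_flow_value:
  assumes G: "G \<in> F_st k" and f: "legal_flow G f"
    and S: "S \<subseteq> nodes G" "source_node G \<in> S" "\<And>v. v \<in> S \<Longrightarrow> \<not> is_sink (state G v)"
  shows "flow_value G f = (\<Sum>v\<in>S. \<Sum>u\<in>neighbors G v - S. f v u)"
proof -
  have fin: "finite S" using F_st_nodes(1)[OF G] S(1) finite_subset by blast
  obtain s where s: "\<And>v. v \<in> nodes G \<Longrightarrow> is_source (state G v) \<longleftrightarrow> v = s" "source_node G = s"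
    using F_st_source_sink[OF G] by metis
  have inner: "(\<Sum>v\<in>S. \<Sum>u\<in>neighbors G v \<inter> S. f v u) = 0"
  proof -
    \<comment> \<open>Extending the flow by 0 to non-adjacent pairs turns the sum into one over
      \<open>S\<close> times \<open>S\<close>, which can be swapped and so equals its own
      negative.\<close>
    define h where "h v u = (if u \<in> neighbors G v then f v u else 0)" for v u
    have anti: "h v u = - h u v" if "v \<in> S" "u \<in> S" for v u
      using f F_st_neighbors(4)[OF G, of u v] that S(1) by (auto simp: h_def legal_flow_def)
    have "(\<Sum>v\<in>S. \<Sum>u\<in>S. h v u) = (\<Sum>v\<in>S. \<Sum>u\<in>S. h u v)" by (rule sum.swap)
    also have "\<dots> = (\<Sum>v\<in>S. \<Sum>u\<in>S. - h v u)" by (intro sum.cong refl anti)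
    also have "\<dots> = - (\<Sum>v\<in>S. \<Sum>u\<in>S. h v u)" by (simp add: sum_negf)
    finally have "(\<Sum>v\<in>S. \<Sum>u\<in>S. h v u) = 0" by linarith
    then show ?thesis
      unfolding h_def using fin by (simp only: Int_commute[of _ S] sum.inter_restrict)
  qed
  have "flow_value G f = (\<Sum>v\<in>S. if v = s then \<Sum>u\<in>neighbors G s. f s u else 0)"
    using S(2) s(2) fin by (simp add: flow_value_def)
  also have "\<dots> = (\<Sum>v\<in>S. \<Sum>u\<in>neighbors G v. f v u)"
    using f S s(1) by (intro sum.cong refl) (auto simp: legal_flow_def)
  also have "\<dots> = (\<Sum>v\<in>S. (\<Sum>u\<in>neighbors G v \<inter> S. f v u) + (\<Sum>u\<in>neighbors G v - S. f v u))"
    using F_st_neighbors(2)[OF G] by (intro sum.cong refl sum.Int_Diff)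
  also have "\<dots> = (\<Sum>v\<in>S. \<Sum>u\<in>neighbors G v - S. f v u)"
    by (simp add: sum.distrib inner)
  finally show ?thesis .
qed

text \<open>Both values are read off at the same cut, where \<open>g\<close> cannot exceed
  \<open>f\<close> on any edge.\<close>

lemma saturated_cut_imp_maximum_flow:
  assumes G: "G \<in> F_st k" and f: "legal_flow G f"
    and S: "S \<subseteq> nodes G" "source_node G \<in> S" "\<And>v. v \<in> S \<Longrightarrow> \<not> is_sink (state G v)"
    and sat: "\<And>v u. v \<in> S \<Longrightarrow> u \<in> neighbors G v - S \<Longrightarrow> f v u = capacity G v u"
  shows "maximum_flow G f"
  unfolding maximum_flow_def
proof (intro conjI allI impI f)
  fix g assume g: "legal_flow G g"
  have "g v u \<le> f v u" if "v \<in> S" "u \<in> neighbors G v - S" for v u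
  proof -
    have "\<bar>g v u\<bar> \<le> capacity G v u" using g that S(1) unfolding legal_flow_def by blast
    then show ?thesis using sat[OF that] by simp
  qed
  then have "(\<Sum>v\<in>S. \<Sum>u\<in>neighbors G v - S. g v u) \<le> (\<Sum>v\<in>S. \<Sum>u\<in>neighbors G v - S. f v u)"
    by (intro sum_mono)
  moreover have "flow_value G h = (\<Sum>v\<in>S. \<Sum>u\<in>neighbors G v - S. h v u)" if "legal_flow G h" for h
    using S by (intro cut_flow_value[OF G that])
  ultimately show "flow_value G g \<le> flow_value G f" using f g by simp
qed

text \<open>
  Augmentation without simple paths: summing unit flows along a residual walk gives a circulation
  \<open>\<delta>\<close> up to the endpoints, which is positive on residual edges only; a small multiple of it can
  be added to the flow.
\<close>

lemma residual_walk_circulation: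
  fixes R :: "nat \<Rightarrow> nat \<Rightarrow> bool"
  assumes G: "G \<in> F_st k" and R: "\<And>v u. R v u \<Longrightarrow> u \<in> neighbors G v" and "R\<^sup>*\<^sup>* s z"
  shows "\<exists>\<delta>::nat \<Rightarrow> nat \<Rightarrow> real. (\<forall>v u. \<delta> v u = - \<delta> u v) \<and> (\<forall>v u. \<delta> v u > 0 \<longrightarrow> R v u) \<and>
    (\<forall>v\<in>nodes G. (\<Sum>u\<in>neighbors G v. \<delta> v u) = of_bool (v = s) - of_bool (v = z))"
  using assms(3)
proof (induction rule: rtranclp_induct)
  case base
  show ?case by (rule exI[of _ "\<lambda>_ _. 0"]) simp
next
  case (step y z)
  then obtain \<delta> :: "nat \<Rightarrow> nat \<Rightarrow> real" where \<delta>: "\<And>v u. \<delta> v u = - \<delta> u v" "\<And>v u. \<delta> v u > 0 \<Longrightarrow> R v u"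
    "\<And>v. v \<in> nodes G \<Longrightarrow> (\<Sum>u\<in>neighbors G v. \<delta> v u) = of_bool (v = s) - of_bool (v = y)"
    by blast
  have zy: "z \<in> neighbors G y" "y \<in> neighbors G z" "y \<noteq> z"
    using R[OF step.hyps(2)] F_st_neighbors(4,5)[OF G] by auto
  \<comment> \<open>One more unit along the last step of the walk. If the walk used the reverse edge
    before, the units cancel, so positivity never arises on a non-residual edge.\<close>
  define \<delta>' where "\<delta>' v u = \<delta> v u + of_bool (v = y \<and> u = z) - of_bool (v = z \<and> u = y)" for v u
  have "\<delta>' v u = - \<delta>' u v" for v u
    unfolding \<delta>'_def by (subst \<delta>(1)[of v u]) (simp add: conj_commute)
  moreover have "R v u" if "\<delta>' v u > 0" for v u
    using that \<delta>(2)[of v u] step.hyps(2) by (cases "v = y \<and> u = z") (auto simp: \<delta>'_def of_bool_def split: if_splits)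
  moreover have "(\<Sum>u\<in>neighbors G v. \<delta>' v u) = of_bool (v = s) - of_bool (v = z)" if v: "v \<in> nodes G" for v
  proof -
    have fin: "finite (neighbors G v)" by (rule F_st_neighbors(2)[OF G])
    have "(\<Sum>u\<in>neighbors G v. of_bool (v = y \<and> u = z)) = (of_bool (v = y) :: real)"
      using zy fin by (cases "v = y") (auto simp: of_bool_def)
    moreover have "(\<Sum>u\<in>neighbors G v. of_bool (v = z \<and> u = y)) = (of_bool (v = z) :: real)"
      using zy fin by (cases "v = z") (auto simp: of_bool_def)
    ultimately show ?thesis using \<delta>(3)[OF v] by (simp add: \<delta>'_def sum.distrib sum_subtractf)
  qed
  ultimately show ?case by blast
qed

text \<open>The cut consists of the nodes reachable from the source by residual edges. Were the sink
  among them, a multiple of the circulation along the walk would improve the flow.\<close>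

lemma MF_imp_saturated_cut:
  assumes G: "G \<in> F_st k" and "MF G"
  obtains S where "S \<subseteq> nodes G" "source_node G \<in> S" "\<And>v. v \<in> S \<Longrightarrow> \<not> is_sink (state G v)"
    "\<And>v u. v \<in> S \<Longrightarrow> u \<in> neighbors G v - S \<Longrightarrow> held_flow G v u = int (capacity G v u)"
proof -
  let ?f = "\<lambda>v u. real_of_int (held_flow G v u)"
  have f: "legal_flow G ?f" and max: "\<And>g. legal_flow G g \<Longrightarrow> flow_value G g \<le> flow_value G ?f"
    using assms(2) by (auto simp: MF_def maximum_flow_def)
  have cap: "\<bar>held_flow G v u\<bar> \<le> int (capacity G v u)" if "u \<in> neighbors G v" for v u
  proof -
    have "\<bar>?f v u\<bar> \<le> real (capacity G v u)"
      using f that F_st_neighbors(3)[OF G that] unfolding legal_flow_def by blast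
    then show ?thesis by linarith
  qed
  obtain s t where s: "s \<in> nodes G" "t \<in> nodes G" "s \<noteq> t"
    "\<And>v. v \<in> nodes G \<Longrightarrow> is_source (state G v) \<longleftrightarrow> v = s"
    "\<And>v. v \<in> nodes G \<Longrightarrow> is_sink (state G v) \<longleftrightarrow> v = t" "source_node G = s"
    by (rule F_st_source_sink[OF G]) blast
  define R where "R v u \<longleftrightarrow> u \<in> neighbors G v \<and> held_flow G v u < int (capacity G v u)" for v u
  define S where "S = {v. R\<^sup>*\<^sup>* s v}"
  have "R\<^sup>*\<^sup>* s v \<Longrightarrow> v \<in> nodes G" for v
    by (induction rule: rtranclp_induct) (use s(1) F_st_neighbors(1)[OF G] in \<open>auto simp: R_def\<close>)
  then have sub: "S \<subseteq> nodes G" by (auto simp: S_def)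
  have "\<not> R\<^sup>*\<^sup>* s t"
  proof
    assume walk: "R\<^sup>*\<^sup>* s t"
    obtain \<delta> :: "nat \<Rightarrow> nat \<Rightarrow> real" where \<delta>: "\<And>v u. \<delta> v u = - \<delta> u v" "\<And>v u. \<delta> v u > 0 \<Longrightarrow> R v u"
      "\<And>v. v \<in> nodes G \<Longrightarrow> (\<Sum>u\<in>neighbors G v. \<delta> v u) = of_bool (v = s) - of_bool (v = t)"
      using residual_walk_circulation[OF G _ walk] R_def by blast
    define B where "B = (\<Sum>v\<in>nodes G. \<Sum>u\<in>nodes G. \<bar>\<delta> v u\<bar>)"
    have fin: "finite (nodes G)" by (rule F_st_nodes(1)[OF G])
    have B: "\<delta> v u \<le> B" if "v \<in> nodes G" "u \<in> nodes G" for v u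
    proof -
      have "\<bar>\<delta> v u\<bar> \<le> (\<Sum>u\<in>nodes G. \<bar>\<delta> v u\<bar>)"
        using that fin by (intro member_le_sum[of u _ "\<lambda>u. \<bar>\<delta> v u\<bar>"]) auto
      also have "\<dots> \<le> B" unfolding B_def
        using that fin by (intro member_le_sum[of v _ "\<lambda>v. \<Sum>u\<in>nodes G. \<bar>\<delta> v u\<bar>"] sum_nonneg) auto
      finally show ?thesis by linarith
    qed
    have "B \<ge> 0" unfolding B_def by (intro sum_nonneg) auto
    \<comment> \<open>Held flows and capacities are integers, so a residual edge has slack at least
      1, while \<open>B\<close> bounds all values of \<delta>. A fractional amount is allowed
      because competing flows are real.\<close>
    define \<epsilon> where "\<epsilon> = 1 / (B + 1)"
    have "\<epsilon> > 0" using \<open>B \<ge> 0\<close> by (simp add: \<epsilon>_def)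
    have \<epsilon>: "\<epsilon> * \<delta> v u \<le> 1" if "v \<in> nodes G" "u \<in> nodes G" for v u
      using B[OF that] \<open>B \<ge> 0\<close> by (simp add: \<epsilon>_def field_simps)
    define g where "g v u = ?f v u + \<epsilon> * \<delta> v u" for v u
    have le: "g v u \<le> real (capacity G v u)" if "u \<in> neighbors G v" for v u
    proof (cases "\<delta> v u > 0")
      case True
      then have "held_flow G v u + 1 \<le> int (capacity G v u)" using \<delta>(2)[OF True] by (simp add: R_def)
      then have "?f v u + 1 \<le> real (capacity G v u)" by linarith
      moreover have "\<epsilon> * \<delta> v u \<le> 1" using F_st_neighbors(1,3)[OF G] that by (intro \<epsilon>) auto
      ultimately show ?thesis by (simp add: g_def)
    next
      case False
      then have "\<epsilon> * \<delta> v u \<le> 0" using \<open>\<epsilon> > 0\<close> by (simp add: mult_nonneg_nonpos)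
      moreover have "?f v u \<le> real (capacity G v u)" using cap[OF that] by linarith
      ultimately show ?thesis by (simp add: g_def)
    qed
    have anti: "g v u = - g u v" if "u \<in> neighbors G v" for v u
    proof -
      have "?f v u = - ?f u v"
        using f that F_st_neighbors(3)[OF G that] unfolding legal_flow_def by blast
      then show ?thesis unfolding g_def using \<delta>(1)[of v u] by (metis add.inverse_distrib_swap add.commute mult_minus_right)
    qed
    have sum_g: "(\<Sum>u\<in>neighbors G v. g v u) = (\<Sum>u\<in>neighbors G v. ?f v u) + \<epsilon> * (of_bool (v = s) - of_bool (v = t))"
      if "v \<in> nodes G" for v
      using \<delta>(3)[OF that] by (simp add: g_def sum.distrib flip: sum_distrib_left)
    have "legal_flow G g"
      unfolding legal_flow_def
    proof (intro conjI ballI impI)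
      fix v u assume v: "v \<in> nodes G" and u: "u \<in> neighbors G v"
      show "g v u = - g u v" by (rule anti[OF u])
      \<comment> \<open>The lower capacity bound is the upper one for the reverse direction.\<close>
      have "u \<in> nodes G" "v \<in> neighbors G u" using F_st_neighbors[OF G] u by auto
      then have "- g v u \<le> real (capacity G v u)"
        using le[of v u] anti[OF u] F_st_nodes(6)[OF G v u] by simp
      then show "\<bar>g v u\<bar> \<le> real (capacity G v u)" using le[OF u] by linarith
    next
      fix v assume v: "v \<in> nodes G" "\<not> is_source (state G v) \<and> \<not> is_sink (state G v)"
      then have "(\<Sum>u\<in>neighbors G v. ?f v u) = 0" using f unfolding legal_flow_def by blast
      then show "(\<Sum>u\<in>neighbors G v. g v u) = 0" using v s sum_g by simp
    qed
    from max[OF this] have "(\<Sum>u\<in>neighbors G s. g s u) \<le> (\<Sum>u\<in>neighbors G s. ?f s u)"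
      by (simp add: flow_value_def s)
    then show False using sum_g[OF s(1)] s(3) \<open>\<epsilon> > 0\<close> by simp
  qed
  show ?thesis
  proof (rule that[OF sub])
    show "source_node G \<in> S" by (simp add: S_def s)
    show "\<not> is_sink (state G v)" if "v \<in> S" for v
      using that sub s(5) \<open>\<not> R\<^sup>*\<^sup>* s t\<close> by (auto simp: S_def)
    fix v u assume "v \<in> S" "u \<in> neighbors G v - S"
    then have "\<not> R v u" using rtranclp.rtrancl_into_rtrancl[of R s v u] by (auto simp: S_def)
    then show "held_flow G v u = int (capacity G v u)"
      using \<open>u \<in> neighbors G v - S\<close> cap[of u v] by (auto simp: R_def)
  qed
qed


section \<open>The upper bound\<close>

text \<open>Every binary digit is preceded by \<open>True\<close>, so that the final \<open>False\<close> makes the code prefix-free.\<close>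

fun enc_nat :: "nat \<Rightarrow> bits" where
  "enc_nat n = (if n = 0 then [False] else True # odd n # enc_nat (n div 2))"

declare enc_nat.simps [simp del]

lemma enc_nat_append_inject: "enc_nat a @ xs = enc_nat b @ ys \<longleftrightarrow> a = b \<and> xs = ys"
proof (induction a arbitrary: b rule: enc_nat.induct)
  case (1 a)
  show ?case
  proof (cases "a = 0 \<or> b = 0")
    case True
    then show ?thesis by (auto simp: enc_nat.simps[of a] enc_nat.simps[of b])
  next
    case False
    have "a = b \<longleftrightarrow> odd a = odd b \<and> a div 2 = b div 2"
      by (metis even_two_times_div_two odd_two_times_div_two_succ)
    then show ?thesis using 1 False by (auto simp: enc_nat.simps[of a] enc_nat.simps[of b])
  qed
qed

lemma length_enc_nat_pos: "n > 0 \<Longrightarrow> real (length (enc_nat n)) \<le> 2 * log 2 (real n) + 3"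
proof (induction n rule: enc_nat.induct)
  case (1 n)
  show ?case
  proof (cases "n = 1")
    case True
    then show ?thesis by (simp add: enc_nat.simps)
  next
    case False
    then have "n div 2 > 0" using 1 by auto
    have "log 2 (real (n div 2)) \<le> log 2 (real n / 2)"
      using \<open>n div 2 > 0\<close> by (intro log_mono) linarith+
    also have "\<dots> = log 2 (real n) - 1" using 1 by (simp add: log_divide)
    finally show ?thesis using 1 \<open>n div 2 > 0\<close> by (simp add: enc_nat.simps[of n])
  qed
qed

lemma length_enc_nat:
  assumes "n \<le> N" "N > 0"
  shows "real (length (enc_nat n)) \<le> 2 * log 2 (real N) + 3"
proof (cases "n = 0")
  case True
  then show ?thesis using assms by (simp add: enc_nat.simps)
next
  case False
  then have "log 2 (real n) \<le> log 2 (real N)" using assms by (intro log_mono) auto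
  then show ?thesis using length_enc_nat_pos[of n] False by linarith
qed

fun enc_entry :: "nat \<times> int \<Rightarrow> bits" where
  "enc_entry (x, f) = enc_nat x @ (f < 0) # enc_nat (nat \<bar>f\<bar>)"

lemma enc_entry_append_inject: "enc_entry a @ xs = enc_entry b @ ys \<longleftrightarrow> a = b \<and> xs = ys"
  by (cases a; cases b) (auto simp: enc_nat_append_inject abs_if split: if_splits)

lemma enc_entry_neq_Nil: "enc_entry a \<noteq> []"
  by (cases a) simp

text \<open>Entries are non-empty and prefix-free. The list ends the message, so it needs neither a
  length field nor a terminator.\<close>

lemma concat_map_enc_entry_inject:
  "concat (map enc_entry es) = concat (map enc_entry es') \<longleftrightarrow> es = es'"
proof (induction es arbitrary: es')
  case Nil
  then show ?case by (cases es') (auto simp: enc_entry_neq_Nil)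
next
  case (Cons a es)
  then show ?case by (cases es') (auto simp: enc_entry_neq_Nil enc_entry_append_inject)
qed

definition enc_message :: "nat \<Rightarrow> bool \<Rightarrow> (nat \<times> int) list \<Rightarrow> bits" where
  "enc_message i b es = b # enc_nat i @ concat (map enc_entry es)"

lemma enc_message_inject: "enc_message i b es = enc_message i' b' es' \<longleftrightarrow> i = i' \<and> b = b' \<and> es = es'"
  by (auto simp: enc_message_def enc_nat_append_inject concat_map_enc_entry_inject)

text \<open>An entry consists of two number codes with overhead 3 each and a sign bit, hence the 7;
  the header is one number code and the side bit, hence the 4.\<close>

lemma length_enc_message:
  assumes "i \<le> N" "N > 0" "fmax > 0"
    and "\<And>x f. (x, f) \<in> set es \<Longrightarrow> x \<le> N \<and> \<bar>f\<bar> \<le> int fmax"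
  shows "real (length (enc_message i b es))
    \<le> (2 * log 2 (real N) + 4) + length es * (2 * log 2 (real N) + 2 * log 2 (real fmax) + 7)"
proof -
  have "real (length (concat (map enc_entry es)))
    \<le> length es * (2 * log 2 (real N) + 2 * log 2 (real fmax) + 7)"
    using assms(4)
  proof (induction es)
    case (Cons a es)
    obtain x f where a: "a = (x, f)" by (cases a)
    have "x \<le> N" "nat \<bar>f\<bar> \<le> fmax" using Cons.prems[of x f] a by auto
    then have "real (length (enc_entry a)) \<le> 2 * log 2 (real N) + 2 * log 2 (real fmax) + 7"
      using length_enc_nat[of x N] length_enc_nat[of "nat \<bar>f\<bar>" fmax] assms(2,3) a by simp
    moreover have "real (length (concat (map enc_entry es)))
      \<le> length es * (2 * log 2 (real N) + 2 * log 2 (real fmax) + 7)"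
      using Cons by auto
    ultimately show ?case by (simp add: algebra_simps)
  qed simp
  then show ?thesis using length_enc_nat[OF assms(1,2)] by (simp add: enc_message_def)
qed

section \<open>The scheme and its model\<close>

text \<open>
  A label consists of the side of a cut and, for every port, either \<open>None\<close> or the identifier of the
  neighbor together with a group number; only the flow on ports of the latter kind is sent.
\<close>

type_synonym label_content = "bool \<times> (nat \<times> nat) option list"

text \<open>Only messages are counted, so a unary index costs nothing. As \<open>dec_label\<close>
  is total, an arbitrary label of an adversary also decodes to some content.\<close>

definition enc_label :: "label_content \<Rightarrow> bits" where
  "enc_label x = replicate (to_nat x) True"

definition dec_label :: "bits \<Rightarrow> label_content" where
  "dec_label l = from_nat (length l)"

lemma dec_enc_label: "dec_label (enc_label x) = x"
  by (simp add: dec_label_def enc_label_def)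

text \<open>Reduction modulo \<open>r\<close> enforces the model for dishonest labels too. A port
  without an entry still receives a message, that of group 0.\<close>

definition port_group :: "nat \<Rightarrow> (nat \<times> nat) option \<Rightarrow> nat" where
  "port_group r w = (case w of None \<Rightarrow> 0 | Some (x, g) \<Rightarrow> g mod r)"

definition group_entries ::
    "nat \<Rightarrow> int list \<Rightarrow> (nat \<times> nat) option list \<Rightarrow> nat \<Rightarrow> (nat \<times> int) list" where
  "group_entries r fs ps g =
     map (\<lambda>q. (fst (the (ps ! q)), fs ! q))
       (filter (\<lambda>q. ps ! q \<noteq> None \<and> port_group r (ps ! q) = g) [0..<length ps])"

definition mf_send :: "nat \<Rightarrow> flow_state \<Rightarrow> bits \<Rightarrow> nat \<Rightarrow> bits" where
  "mf_send r st l p = (case dec_label l of (b, ps) \<Rightarrow>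
     enc_message (ident st) b (group_entries r (flows st) ps (port_group r (ps ! p))))"

text \<open>Either the label claims the neighbor's identifier, and the claim is checked, or the
  neighbor must list this node. In both cases every flow listed for this node is compared with the
  own one. The last condition is saturation of the cut, checked at the end on the source
  side.\<close>

definition mf_check :: "flow_state \<Rightarrow> bool \<Rightarrow> (nat \<times> nat) option \<Rightarrow> nat \<Rightarrow> bits \<Rightarrow> bool" where
  "mf_check st b w p m \<longleftrightarrow> (\<exists>i b' es. m = enc_message i b' es \<and>
     (case w of None \<Rightarrow> ident st \<in> fst ` set es | Some (x, g) \<Rightarrow> x = i) \<and>
     (\<forall>f. (ident st, f) \<in> set es \<longrightarrow> f = - flows st ! p) \<and>
     \<bar>flows st ! p\<bar> \<le> int (caps st ! p) \<and>
     (b \<and> \<not> b' \<longrightarrow> flows st ! p = int (caps st ! p)))"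

definition mf_decide :: "flow_state \<Rightarrow> bits \<Rightarrow> bits list \<Rightarrow> bool" where
  "mf_decide st l ms = (case dec_label l of (b, ps) \<Rightarrow>
     length ps = length ms \<and> (\<forall>p<length ms. mf_check st b (ps ! p) p (ms ! p)) \<and>
     (\<not> is_source st \<and> \<not> is_sink st \<longrightarrow> sum_list (flows st) = 0) \<and>
     (is_source st \<longrightarrow> b) \<and> (is_sink st \<longrightarrow> \<not> b))"

definition mf_pls :: "nat \<Rightarrow> (flow_state configuration \<Rightarrow> nat \<Rightarrow> bits) \<Rightarrow> flow_state pls" where
  "mf_pls r P = \<lparr>prover = P, send = mf_send r, decide = mf_decide\<rparr>"

lemma mf_pls_simps [simp]:
  "prover (mf_pls r P) = P" "send (mf_pls r P) = mf_send r" "decide (mf_pls r P) = mf_decide"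
  by (simp_all add: mf_pls_def)

text \<open>\<open>mf_send\<close> depends on the port only through its group, which is below
  \<open>r\<close> for every label, even where the list \<open>ps\<close> is too short.\<close>

lemma in_MCAST_mf_pls:
  assumes "r \<ge> 1"
  shows "in_MCAST r \<F> (mf_pls r P)"
  unfolding in_MCAST_def mf_pls_simps
proof (intro ballI allI)
  fix G v l
  obtain b ps where "dec_label l = (b, ps)" by (cases "dec_label l")
  then have "mf_send r (state G v) l ` {..<degree G v} \<subseteq>
    (\<lambda>g. enc_message (ident (state G v)) b (group_entries r (flows (state G v)) ps g)) ` {..<r}"
    using assms by (auto simp: mf_send_def port_group_def split: option.split intro!: imageI)
  then have "card (mf_send r (state G v) l ` {..<degree G v}) \<le> card {..<r}"
    by (rule surj_card_le[OF finite_lessThan])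
  then show "card (mf_send r (state G v) l ` {..<degree G v}) \<le> r" by simp
qed

lemma group_entries_iff:
  "(x, f) \<in> set (group_entries r fs ps g) \<longleftrightarrow>
     (\<exists>q<length ps. \<exists>g'. ps ! q = Some (x, g') \<and> g' mod r = g \<and> f = fs ! q)"
  by (force simp: group_entries_def port_group_def)

lemma sum_neighbors_held_flow:
  assumes "G \<in> F_st k" "v \<in> nodes G"
  shows "(\<Sum>u\<in>neighbors G v. held_flow G v u) = sum_list (flows (state G v))"
proof -
  note ports = F_st_ports[OF assms]
  have "map (held_flow G v) (ports G v) = flows (state G v)"
    using F_st_nodes(5)[OF assms] port_of_nth[OF ports(1)]
    by (intro nth_equalityI) (auto simp: degree_def held_flow_def)
  then show ?thesis using sum_list_distinct_conv_sum_set[OF ports(1), of "held_flow G v"] ports(2) by simp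
qed

section \<open>Soundness and completeness\<close>

text \<open>The point is anti-symmetry; the rest is checked locally, and the nodes with side bit
  \<open>True\<close> form a saturated cut.\<close>

lemma accepted_mf_pls_imp_MF:
  assumes G: "G \<in> F_st k" and acc: "accepted (mf_pls r P) G l"
  shows "MF G"
proof -
  define side where "side v = fst (dec_label (l v))" for v
  define ps where "ps v = snd (dec_label (l v))" for v
  define es where "es v g = group_entries r (flows (state G v)) (ps v) g" for v g
  define fl where "fl v p = flows (state G v) ! p" for v p
  have dec: "dec_label (l v) = (side v, ps v)" for v by (simp add: side_def ps_def)
  have msg: "message (mf_pls r P) G l u v =
    enc_message (ident (state G u)) (side u) (es u (port_group r (ps u ! port_of G u v)))" for u v
    by (simp add: message_def mf_send_def dec es_def)
  have D: "mf_decide (state G v) (l v) (map (\<lambda>u. message (mf_pls r P) G l u v) (ports G v))"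
    if "v \<in> nodes G" for v
    using acc that by (simp add: accepted_def)
  have len: "length (ps v) = degree G v" if "v \<in> nodes G" for v
    using D[OF that] by (simp add: mf_decide_def dec degree_def)
  have chk: "case ps v ! p of
        None \<Rightarrow> ident (state G v) \<in> fst ` set (es u (port_group r (ps u ! port_of G u v)))
      | Some (x, g) \<Rightarrow> x = ident (state G u)"
    "\<And>f. (ident (state G v), f) \<in> set (es u (port_group r (ps u ! port_of G u v))) \<Longrightarrow> f = - fl v p"
    "\<bar>fl v p\<bar> \<le> int (caps (state G v) ! p)"
    "side v \<Longrightarrow> \<not> side u \<Longrightarrow> fl v p = int (caps (state G v) ! p)"
    if "v \<in> nodes G" "p < degree G v" "u = ports G v ! p" for v p u
  proof -
    have "mf_check (state G v) (side v) (ps v ! p) p (message (mf_pls r P) G l u v)"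
      using D[OF that(1)] that(2,3) by (auto simp: mf_decide_def dec degree_def)
    then obtain i b' es' where *: "message (mf_pls r P) G l u v = enc_message i b' es'"
      "case ps v ! p of None \<Rightarrow> ident (state G v) \<in> fst ` set es' | Some (x, g) \<Rightarrow> x = i"
      "\<forall>f. (ident (state G v), f) \<in> set es' \<longrightarrow> f = - fl v p" 
      "\<bar>fl v p\<bar> \<le> int (caps (state G v) ! p)"
      "side v \<and> \<not> b' \<longrightarrow> fl v p = int (caps (state G v) ! p)"
      unfolding mf_check_def fl_def by blast
    have eqs: "ident (state G u) = i" "side u = b'" "es u (port_group r (ps u ! port_of G u v)) = es'"
      using *(1) unfolding msg enc_message_inject by simp_all
    show "case ps v ! p of
        None \<Rightarrow> ident (state G v) \<in> fst ` set (es u (port_group r (ps u ! port_of G u v)))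
      | Some (x, g) \<Rightarrow> x = ident (state G u)"
      using *(2) by (simp only: eqs)
    show "f = - fl v p" if "(ident (state G v), f) \<in> set (es u (port_group r (ps u ! port_of G u v)))" for f
      using *(3) that by (simp only: eqs)
    show "\<bar>fl v p\<bar> \<le> int (caps (state G v) ! p)" by (rule *(4))
    show "side v \<Longrightarrow> \<not> side u \<Longrightarrow> fl v p = int (caps (state G v) ! p)" using *(5) eqs(2) by simp
  qed
  have anti: "held_flow G v u = - held_flow G u v" if u: "u \<in> neighbors G v" for v u
  proof -
    have nodes: "v \<in> nodes G" "u \<in> nodes G" and v: "v \<in> neighbors G u"
      using F_st_neighbors[OF G] u by auto
    define p q where "p = port_of G v u" and "q = port_of G u v"
    have p: "p < degree G v" "u = ports G v ! p" and q: "q < degree G u" "v = ports G u ! q"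
      using F_st_port_of[OF G u] F_st_port_of[OF G v] by (auto simp: p_def q_def)
    have fl: "held_flow G v u = fl v p" "held_flow G u v = fl u q"
      by (simp_all add: held_flow_def fl_def p_def q_def)
    show ?thesis
    proof (cases "ps v ! p")
      \<comment> \<open>Here \<open>v\<close> lists the true identifier of \<open>u\<close>, so
        \<open>u\<close> finds itself in the message and compares.\<close>
      case (Some w)
      then obtain x g where x: "ps v ! p = Some (x, g)" by (cases w) auto
      then have "x = ident (state G u)" using chk(1)[OF nodes(1) p] by simp
      then have "(ident (state G u), fl v p) \<in> set (es v (port_group r (ps v ! p)))"
        using x p(1) len[OF nodes(1)] by (auto simp: es_def group_entries_iff port_group_def fl_def)
      then show ?thesis using chk(2)[OF nodes(2) q, of "fl v p"] fl by (simp add: p_def)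
    next
      case None
      then have "ident (state G v) \<in> fst ` set (es u (port_group r (ps u ! q)))"
        using chk(1)[OF nodes(1) p] by (simp add: q_def)
      then obtain f where f: "(ident (state G v), f) \<in> set (es u (port_group r (ps u ! q)))" by auto
      then obtain q' g' where q': "q' < length (ps u)" "ps u ! q' = Some (ident (state G v), g')"
        "f = fl u q'"
        by (auto simp: es_def group_entries_iff fl_def)
      then have "q' < degree G u" using len[OF nodes(2)] by simp
      \<comment> \<open>The neighbor behind port \<open>q'\<close> has verified the claim of
        \<open>u\<close> about it. Uniqueness of identifiers then forces \<open>q' = q\<close>, so
        the listed flow belongs to this very edge.\<close>
      then have "ident (state G v) = ident (state G (ports G u ! q'))" and "ports G u ! q' \<in> nodes G"
        using chk(1)[OF nodes(2) _ refl, of q'] q' F_st_ports(2)[OF G nodes(2)] F_st_neighbors(1)[OF G, of u]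
        by (auto simp: degree_def)
      then have "v = ports G u ! q'" using F_st_nodes(2)[OF G] nodes by (auto dest: inj_onD)
      then have "q' = q" using port_of_nth[of G u q'] F_st_ports(1)[OF G nodes(2)] \<open>q' < degree G u\<close>
        by (simp add: q_def)
      then show ?thesis using chk(2)[OF nodes(1) p, of f] f q' fl by (simp add: q_def)
    qed
  qed
  let ?f = "\<lambda>v u. real_of_int (held_flow G v u)"
  have cap: "\<bar>held_flow G v u\<bar> \<le> int (capacity G v u)" if "u \<in> neighbors G v" for v u
    using chk(3)[OF F_st_neighbors(3)[OF G that] F_st_port_of(1)[OF G that] refl]
    by (simp add: held_flow_def capacity_def fl_def)
  have "legal_flow G ?f"
    unfolding legal_flow_def
  proof (intro conjI ballI impI)
    fix v assume v: "v \<in> nodes G" "\<not> is_source (state G v) \<and> \<not> is_sink (state G v)"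
    then have "(\<Sum>u\<in>neighbors G v. held_flow G v u) = 0"
      using D[OF v(1)] sum_neighbors_held_flow[OF G v(1)] by (simp add: mf_decide_def dec)
    then show "(\<Sum>u\<in>neighbors G v. ?f v u) = 0" by (simp flip: of_int_sum)
  next
    fix v u assume u: "u \<in> neighbors G v"
    show "?f v u = - ?f u v" by (subst anti[OF u]) simp
    show "\<bar>?f v u\<bar> \<le> real (capacity G v u)" using cap[OF u] by linarith
  qed
  moreover have "source_node G \<in> nodes G \<and> is_source (state G (source_node G))"
    by (rule F_st_source_sink[OF G]) auto
  then have "side (source_node G)" "source_node G \<in> nodes G"
    using D[of "source_node G"] by (auto simp: mf_decide_def dec)
  moreover have "\<not> is_sink (state G v)" if "v \<in> nodes G" "side v" for v
    using D[OF that(1)] that(2) by (simp add: mf_decide_def dec)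
  moreover have "?f v u = real (capacity G v u)" if "u \<in> neighbors G v" "side v" "\<not> side u" for v u
    using that chk(4)[OF F_st_neighbors(3)[OF G that(1)] F_st_port_of(1)[OF G that(1)] refl] F_st_port_of(2)[OF G that(1)]
    by (simp add: held_flow_def capacity_def fl_def)
  moreover have "u \<in> nodes G" if "u \<in> neighbors G v" for u v using F_st_neighbors(1)[OF G] that by blast
  ultimately show ?thesis
    unfolding MF_def
    by (intro saturated_cut_imp_maximum_flow[OF G, where S = "{v \<in> nodes G. side v}"]) auto
qed

text \<open>Sending and deciding ignore the prover, so the labels can be chosen uniformly in
  \<open>P\<close>; the prover is then defined from them afterwards. They are uniform in
  \<open>fmax\<close> as well, since the scheme is fixed before the length bound is read
  off.\<close>

lemma MF_imp_accepted_mf_pls: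
  assumes G: "G \<in> F_st k" and MF: "MF G" and r: "r \<ge> 1"
  shows "\<exists>l. \<forall>P. accepted (mf_pls r P) G l \<and> (\<forall>fmax>0. (\<forall>v\<in>nodes G. \<forall>u\<in>neighbors G v. \<bar>held_flow G v u\<bar> \<le> int fmax) \<longrightarrow>
    (\<forall>v\<in>nodes G. \<forall>u\<in>neighbors G v. real (length (message (mf_pls r P) G l v u)) \<le>
      (2 * log 2 (real (card (nodes G) ^ k)) + 4) + (real (arboricity G) / real r + 1) *
        (2 * log 2 (real (card (nodes G) ^ k)) + 2 * log 2 (real fmax) + 7)))"
proof -
  obtain S where S: "S \<subseteq> nodes G" "source_node G \<in> S" "\<And>v. v \<in> S \<Longrightarrow> \<not> is_sink (state G v)"
    "\<And>v u. v \<in> S \<Longrightarrow> u \<in> neighbors G v - S \<Longrightarrow> held_flow G v u = int (capacity G v u)"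
    by (rule MF_imp_saturated_cut[OF G MF]) blast
  obtain tail idx where tail: "\<And>e. e \<in> edges G \<Longrightarrow> tail e \<in> e" "\<And>e. e \<in> edges G \<Longrightarrow> idx e < arboricity G"
    "\<And>v. inj_on idx {e \<in> edges G. tail e = v}"
    unfolding arboricity_eq_edge_arboricity
    by (rule edge_arboricity_orientation[OF F_st_edges(1)[OF G] F_st_edges(3)[OF G]]) blast+
  define a where "a = arboricity G"
  \<comment> \<open>The ceiling of \<alpha> / \<open>r\<close>. Group \<open>g\<close> takes the
    \<open>c\<close> consecutive forests from \<open>g * c\<close> on, which makes at most
    \<open>r\<close> groups.\<close>
  define c where "c = (a + r - 1) div r"
  have c_le: "real c \<le> real a / real r + 1"
  proof -
    have "real c \<le> real (a + r - 1) / real r" unfolding c_def by (rule of_nat_div_le_of_nat)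
    also have "\<dots> \<le> (real a + real r) / real r" by (intro divide_right_mono) auto
    also have "\<dots> = real a / real r + 1" using r by (simp add: add_divide_distrib)
    finally show ?thesis .
  qed
  have grp: "idx e div c < r" if "e \<in> edges G" for e
  proof -
    have "a \<le> r * c"
    proof -
      have "a + r - 1 < r * c + r" 
        using r mult_div_mod_eq[of r "a + r - 1"] mod_less_divisor[of r "a + r - 1"] unfolding c_def by linarith
      then show ?thesis by linarith
    qed
    then have "idx e < r * c" using tail(2)[OF that] by (simp add: a_def)
    then show ?thesis by (simp add: less_mult_imp_div_less)
  qed
  \<comment> \<open>Only the tail of an edge lists it.\<close>
  define w where "w v u = (if tail {v, u} = v then Some (ident (state G u), idx {v, u} div c) else None)" for v u
  define ps where "ps v = map (w v) (ports G v)" for v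
  define l where "l v = enc_label (v \<in> S, ps v)" for v
  define es where "es v u = group_entries r (flows (state G v)) (ps v) (port_group r (w v u))" for v u
  note dec = l_def dec_enc_label
  have ps_nth: "ps v ! p = w v (ports G v ! p)" if "p < degree G v" for v p
    using that by (simp add: ps_def degree_def)
  have msg: "message (mf_pls r P) G l v u = enc_message (ident (state G v)) (v \<in> S) (es v u)"
    if "u \<in> neighbors G v" for v u P
    using F_st_port_of[OF G that] by (simp add: message_def mf_send_def dec es_def ps_nth)
  have f: "legal_flow G (\<lambda>v u. real_of_int (held_flow G v u))" using MF by (simp add: MF_def maximum_flow_def)
  have es_iff: "(x, f) \<in> set (es v u) \<longleftrightarrow> (\<exists>y\<in>neighbors G v. tail {v, y} = v \<and> x = ident (state G y) \<and>
      f = held_flow G v y \<and> port_group r (w v y) = port_group r (w v u))" if v: "v \<in> nodes G" for x f v u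
  proof
    assume "(x, f) \<in> set (es v u)"
    then obtain q g' where q: "q < degree G v" "ps v ! q = Some (x, g')" "g' mod r = port_group r (w v u)"
      "f = flows (state G v) ! q"
      by (auto simp: es_def group_entries_iff ps_def degree_def)
    define y where "y = ports G v ! q"
    have "y \<in> neighbors G v"
      using q(1) nth_mem[of q "ports G v"] F_st_ports(2)[OF G v] by (simp add: y_def degree_def)
    moreover have "port_of G v y = q" unfolding y_def by (rule port_of_nth[OF F_st_ports(1)[OF G v] q(1)])
    ultimately show "\<exists>y\<in>neighbors G v. tail {v, y} = v \<and> x = ident (state G y) \<and>
      f = held_flow G v y \<and> port_group r (w v y) = port_group r (w v u)"
      using q ps_nth[OF q(1)] by (intro bexI[of _ y])
        (auto simp: y_def[symmetric] w_def held_flow_def port_group_def split: if_splits)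
  next
    assume "\<exists>y\<in>neighbors G v. tail {v, y} = v \<and> x = ident (state G y) \<and>
      f = held_flow G v y \<and> port_group r (w v y) = port_group r (w v u)"
    then obtain y where y: "y \<in> neighbors G v" "tail {v, y} = v" "x = ident (state G y)"
      "f = held_flow G v y" "port_group r (w v y) = port_group r (w v u)" by blast
    then show "(x, f) \<in> set (es v u)"
      using F_st_port_of[OF G y(1)] ps_nth[OF F_st_port_of(1)[OF G y(1)]]
      unfolding es_def group_entries_iff
      by (intro exI[of _ "port_of G v y"])
        (auto simp: ps_def degree_def w_def held_flow_def port_group_def)
  qed
  have acc: "accepted (mf_pls r P) G l" for P
    unfolding accepted_def mf_pls_simps
  proof
    fix v assume v: "v \<in> nodes G"
    let ?ms = "map (\<lambda>u. message (mf_pls r P) G l u v) (ports G v)"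
    have "mf_check (state G v) (v \<in> S) (ps v ! p) p (?ms ! p)" if p: "p < degree G v" for p
    proof -
      define u where "u = ports G v ! p"
      have "u \<in> neighbors G v"
        using p nth_mem[of p "ports G v"] F_st_ports(2)[OF G v] by (simp add: u_def degree_def)
      then have u: "u \<in> neighbors G v" "v \<in> neighbors G u" "u \<in> nodes G" "{v, u} \<in> edges G"
        using F_st_neighbors(1)[OF G, of v] F_st_neighbors(4)[OF G, of u v] by (blast, blast, blast, simp add: neighbors_def)
      have pu: "port_of G v u = p" unfolding u_def by (rule port_of_nth[OF F_st_ports(1)[OF G v] p])
      have fl: "flows (state G v) ! p = held_flow G v u" "caps (state G v) ! p = capacity G v u"
        by (simp_all add: held_flow_def capacity_def pu)
      have m: "?ms ! p = enc_message (ident (state G u)) (u \<in> S) (es u v)"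
        using p msg[OF u(2)] by (simp add: u_def degree_def)
      have anti: "held_flow G u v = - held_flow G v u"
      proof -
        have "real_of_int (held_flow G u v) = - real_of_int (held_flow G v u)"
          using f u unfolding legal_flow_def by blast
        then show ?thesis by linarith
      qed
      have cap: "\<bar>held_flow G v u\<bar> \<le> int (capacity G v u)"
      proof -
        have "\<bar>real_of_int (held_flow G v u)\<bar> \<le> real (capacity G v u)"
          using f u v unfolding legal_flow_def by blast
        then show ?thesis by linarith
      qed
      \<comment> \<open>If \<open>v\<close> is not the tail then \<open>u\<close> is, and the group
        of \<open>u\<close> addressed to \<open>v\<close> contains the entry for
        \<open>v\<close>.\<close>
      have "ident (state G v) \<in> fst ` set (es u v)" if "tail {v, u} \<noteq> v"
      proof -
        have "tail {u, v} = u" using tail(1)[OF u(4)] that by (auto simp: insert_commute)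
        then have "(ident (state G v), held_flow G u v) \<in> set (es u v)" using es_iff[OF u(3)] u(2) by blast
        then show ?thesis by force
      qed
      moreover have "f = - held_flow G v u" if entry: "(ident (state G v), f) \<in> set (es u v)" for f
      proof -
        obtain y where y: "y \<in> neighbors G u" "ident (state G v) = ident (state G y)" "f = held_flow G u y"
          using entry unfolding es_iff[OF u(3)] by blast
        have "y \<in> nodes G" using F_st_neighbors(1)[OF G, of u] y(1) by blast
        then have "v = y" using inj_onD[OF F_st_nodes(2)[OF G] y(2)] v by simp
        then show ?thesis using y(3) anti by simp
      qed
      moreover have "held_flow G v u = int (capacity G v u)" if "v \<in> S" "u \<notin> S"
        using S(4)[of v u] u(1) that by simp
      ultimately show ?thesis
        unfolding mf_check_def m fl using cap ps_nth[OF p] u_def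
        by (intro exI[of _ "ident (state G u)"] exI[of _ "u \<in> S"] exI[of _ "es u v"])
          (auto simp: w_def)
    qed
    moreover have "sum_list (flows (state G v)) = 0" if "\<not> is_source (state G v) \<and> \<not> is_sink (state G v)"
    proof -
      have "(\<Sum>u\<in>neighbors G v. real_of_int (held_flow G v u)) = 0" using f v that unfolding legal_flow_def by blast
      then have "real_of_int (\<Sum>u\<in>neighbors G v. held_flow G v u) = 0" by simp
      then show ?thesis using sum_neighbors_held_flow[OF G v] by simp
    qed
    moreover have "is_source (state G v) \<Longrightarrow> v = source_node G"
      by (rule F_st_source_sink[OF G]) (use v in auto)
    then have "is_source (state G v) \<Longrightarrow> v \<in> S" using S(2) by simp
    ultimately show "mf_decide (state G v) (l v) ?ms"
      using S(3)[of v] unfolding mf_decide_def by (auto simp: dec degree_def ps_def)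
  qed
  have len_es: "length (es v u) \<le> c" if v: "v \<in> nodes G" and u: "u \<in> neighbors G v" for v u
  proof -
    define g where "g = port_group r (w v u)"
    let ?Q = "{q. q < length (ps v) \<and> (ps v ! q \<noteq> None \<and> port_group r (ps v ! q) = g)}"
    let ?e = "\<lambda>q. {v, ports G v ! q}"
    have "length (es v u) = card ?Q"
    proof -
      have "length (es v u) = length (filter (\<lambda>q. ps v ! q \<noteq> None \<and> port_group r (ps v ! q) = g) [0..<length (ps v)])"
        by (simp add: es_def group_entries_def g_def)
      also have "\<dots> = card (set (filter (\<lambda>q. ps v ! q \<noteq> None \<and> port_group r (ps v ! q) = g) [0..<length (ps v)]))"
        by (rule distinct_card[symmetric]) simp
      finally show ?thesis by simp
    qed
    \<comment> \<open>The outgoing edges of \<open>v\<close> lie in distinct forests, and those of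
      group \<open>g\<close> in a block of \<open>c\<close> forests.\<close>
    also have "card ?Q \<le> card {g * c..<g * c + c}"
    proof (rule card_inj_on_le[of "\<lambda>q. idx (?e q)"])
      have Q: "?e q \<in> edges G" "tail (?e q) = v" "idx (?e q) div c = g" "q < degree G v" if "q \<in> ?Q" for q
      proof -
        from that show q: "q < degree G v" by (simp add: ps_def degree_def)
        then show "?e q \<in> edges G" using F_st_ports(2)[OF G v] by (force simp: degree_def neighbors_def)
        have "w v (ports G v ! q) \<noteq> None" "port_group r (w v (ports G v ! q)) = g"
          using that ps_nth[OF q] by auto
        then show "tail (?e q) = v" "idx (?e q) div c = g"
          using grp[OF \<open>?e q \<in> edges G\<close>] by (auto simp: w_def port_group_def split: if_splits)
      qed
      show "inj_on (\<lambda>q. idx (?e q)) ?Q"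
      proof (rule inj_onI)
        fix q q' assume q: "q \<in> ?Q" "q' \<in> ?Q" "idx (?e q) = idx (?e q')"
        then have "?e q = ?e q'" using tail(3)[of v] Q[OF q(1)] Q[OF q(2)] by (auto dest: inj_onD)
        then have "ports G v ! q = ports G v ! q'" by (auto simp: doubleton_eq_iff)
        then show "q = q'"
          using Q(4)[OF q(1)] Q(4)[OF q(2)] F_st_ports(1)[OF G v] by (simp add: degree_def nth_eq_iff_index_eq)
      qed
      show "(\<lambda>q. idx (?e q)) ` ?Q \<subseteq> {g * c..<g * c + c}"
      proof
        fix i assume "i \<in> (\<lambda>q. idx (?e q)) ` ?Q"
        then obtain q where q: "q \<in> ?Q" "i = idx (?e q)" by blast
        have "c > 0"
        proof -
          have "a \<ge> 1" using tail(2)[OF Q(1)[OF q(1)]] by (simp add: a_def)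
          then have "r div r \<le> c" unfolding c_def by (intro div_le_mono) simp
          then show ?thesis using r by simp
        qed
        then have "i mod c < c" by simp
        moreover have "i = g * c + i mod c" using Q(3)[OF q(1)] q(2) div_mult_mod_eq[of i c] by simp
        ultimately show "i \<in> {g * c..<g * c + c}" by simp
      qed
    qed simp
    finally show ?thesis by simp
  qed
  have len: "real (length (message (mf_pls r P) G l v u)) \<le>
      (2 * log 2 (real (card (nodes G) ^ k)) + 4) + (real (arboricity G) / real r + 1) *
        (2 * log 2 (real (card (nodes G) ^ k)) + 2 * log 2 (real fmax) + 7)"
    if fm: "fmax > 0" "\<forall>v\<in>nodes G. \<forall>u\<in>neighbors G v. \<bar>held_flow G v u\<bar> \<le> int fmax"
      and v: "v \<in> nodes G" and u: "u \<in> neighbors G v" for fmax v u P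
  proof -
    let ?N = "card (nodes G) ^ k"
    let ?D = "2 * log 2 (real ?N) + 2 * log 2 (real fmax) + 7"
    have "card (nodes G) > 0" using v F_st_nodes(1)[OF G] by (auto simp: card_gt_0_iff)
    then have N: "?N > 0" by simp
    have "real (length (message (mf_pls r P) G l v u)) \<le> (2 * log 2 (real ?N) + 4) + length (es v u) * ?D"
      unfolding msg[OF u]
    proof (rule length_enc_message[OF F_st_nodes(3)[OF G v] N fm(1)])
      fix x f assume "(x, f) \<in> set (es v u)"
      then obtain y where "y \<in> neighbors G v" "x = ident (state G y)" "f = held_flow G v y"
        using es_iff[OF v] by blast
      then show "x \<le> ?N \<and> \<bar>f\<bar> \<le> int fmax"
        using fm(2) v F_st_nodes(3)[OF G, of y] F_st_neighbors(1)[OF G, of v] by auto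
    qed
    also have "\<dots> \<le> (2 * log 2 (real ?N) + 4) + (real (arboricity G) / real r + 1) * ?D"
    proof -
      have "0 \<le> log 2 (real m)" if "m > 0" for m :: nat using that by simp
      from this[OF N] this[OF fm(1)] have "?D \<ge> 0" by linarith
      moreover have "real (length (es v u)) \<le> real (arboricity G) / real r + 1"
        using len_es[OF v u] c_le by (simp add: a_def)
      ultimately show ?thesis by (intro add_left_mono mult_right_mono)
    qed
    finally show ?thesis .
  qed
  show ?thesis using acc len by (intro exI[of _ l]) simp
qed

section \<open>The complexity of the scheme\<close>

lemma scheme_complexity_le:
  assumes "\<And>G v u. G \<in> \<C> \<Longrightarrow> P G \<Longrightarrow> v \<in> nodes G \<Longrightarrow> u \<in> neighbors G v \<Longrightarrow>
    real (length (message A G (prover A G) v u)) \<le> x" and "x \<ge> 0"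
  shows "ereal_of_enat (scheme_complexity \<C> P A) \<le> ereal x"
proof -
  have "scheme_complexity \<C> P A \<le> enat (nat \<lfloor>x\<rfloor>)"
    unfolding scheme_complexity_def
  proof (rule Sup_least)
    fix y assume "y \<in> {enat (length (message A G (prover A G) v u)) | G v u.
      G \<in> \<C> \<and> P G \<and> v \<in> nodes G \<and> u \<in> neighbors G v}"
    then obtain G v u where y: "y = enat (length (message A G (prover A G) v u))"
      and "real (length (message A G (prover A G) v u)) \<le> x" using assms(1) by blast
    then have "length (message A G (prover A G) v u) \<le> nat \<lfloor>x\<rfloor>" by linarith
    then show "y \<le> enat (nat \<lfloor>x\<rfloor>)" using y by simp
  qed
  then have "ereal_of_enat (scheme_complexity \<C> P A) \<le> ereal_of_enat (enat (nat \<lfloor>x\<rfloor>))"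
    by (simp only: ereal_of_enat_le_iff)
  also have "\<dots> \<le> ereal x" using assms(2) by simp
  finally show ?thesis .
qed

lemma F_st_card_nodes: "G \<in> F_st k \<Longrightarrow> card (nodes G) \<ge> 2"
proof -
  assume G: "G \<in> F_st k"
  obtain s t where "s \<in> nodes G" "t \<in> nodes G" "s \<noteq> t" by (rule F_st_source_sink[OF G]) blast
  then have "card {s, t} \<le> card (nodes G)" using F_st_nodes(1)[OF G] by (intro card_mono) auto
  then show ?thesis using \<open>s \<noteq> t\<close> by simp
qed

text \<open>The assumption on \<open>fmax\<close> bounds the cost of identifiers by that of flows,
  up to the factor \<open>k / \<kappa>\<close>; since \<open>n\<close> is at least 2, it also
  absorbs the additive constants.\<close>

lemma MF_complexity_upper:
  fixes \<kappa> :: real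
  assumes "\<kappa> > 0" "n \<ge> 2" and F: "log 2 (real fmax) \<ge> \<kappa> * log 2 (real n)"
    and r: "1 \<le> r" "real r \<le> real \<alpha>"
  shows "ereal_of_enat (MF_complexity k n \<alpha> fmax r) \<le>
    ereal (3 * ((2 * real k + 7) / \<kappa> + 2) * (real \<alpha> / real r * log 2 (real fmax)))"
    (is "_ \<le> ereal ?X")
proof -
  define bound where "bound G (f :: nat) = (2 * log 2 (real (card (nodes G) ^ k)) + 4) +
    (real (arboricity G) / real r + 1) * (2 * log 2 (real (card (nodes G) ^ k)) + 2 * log 2 (real f) + 7)"
    for G :: "flow_state configuration" and f
  define good where "good G l \<longleftrightarrow> (\<forall>P. accepted (mf_pls r P) G l \<and>
    (\<forall>f>0. (\<forall>v\<in>nodes G. \<forall>u\<in>neighbors G v. \<bar>held_flow G v u\<bar> \<le> int f) \<longrightarrow>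
    (\<forall>v\<in>nodes G. \<forall>u\<in>neighbors G v. real (length (message (mf_pls r P) G l v u)) \<le> bound G f)))" for G l
  have "\<forall>G. \<exists>l. G \<in> F_st k \<and> MF G \<longrightarrow> good G l"
    using MF_imp_accepted_mf_pls[OF _ _ r(1)] unfolding good_def bound_def by blast
  then obtain L where L: "\<And>G. G \<in> F_st k \<Longrightarrow> MF G \<Longrightarrow> good G (L G)" by metis
  let ?A = "mf_pls r L"
  have pls: "is_pls (F_st k) MF ?A"
    unfolding is_pls_def using L accepted_mf_pls_imp_MF by (auto simp: good_def)
  let ?F = "log 2 (real fmax)" and ?q = "real \<alpha> / real r"
  have "log 2 (real n) \<ge> 1" using assms(2) by simp
  then have F1: "?F \<ge> \<kappa>" using F assms(1) by (smt (verit) mult_le_cancel_left1)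
  \<comment> \<open>The logarithm of 0 is 0 by convention, below \<kappa>.\<close>
  have fmax: "fmax > 0" using F1 assms(1) by (cases "fmax = 0") (auto simp: log_def)
  have q: "?q \<ge> 1" using r by simp
  have le: "(2 * log 2 (real (n ^ k)) + 4) + (?q + 1) * (2 * log 2 (real (n ^ k)) + 2 * ?F + 7) \<le> ?X"
  proof -
    let ?D = "((2 * real k + 7) / \<kappa> + 2) * ?F"
    have "log 2 (real n) \<le> ?F / \<kappa>" using F assms(1) by (simp add: field_simps)
    then have "real k * log 2 (real n) \<le> real k * (?F / \<kappa>)" by (intro mult_left_mono) auto
    moreover have "log 2 (real (n ^ k)) = real k * log 2 (real n)" using assms(2) by (simp add: log_nat_power)
    moreover have "7 \<le> 7 * (?F / \<kappa>)" using F1 assms(1) by (simp add: field_simps)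
    ultimately have D: "2 * log 2 (real (n ^ k)) + 2 * ?F + 7 \<le> ?D"
      by (simp add: add_divide_distrib distrib_right)
    moreover have "?F \<ge> 0" using F1 assms(1) by simp
    ultimately have "2 * log 2 (real (n ^ k)) + 4 \<le> ?D" by linarith
    moreover have "(?q + 1) * (2 * log 2 (real (n ^ k)) + 2 * ?F + 7) \<le> (?q + 1) * ?D"
      using D q by (intro mult_left_mono) auto
    ultimately have "(2 * log 2 (real (n ^ k)) + 4) + (?q + 1) * (2 * log 2 (real (n ^ k)) + 2 * ?F + 7)
      \<le> ?D + (?q + 1) * ?D" by (rule add_mono)
    also have "\<dots> = (?q + 2) * ?D"
    proof -
      have "x + (y + 1) * x = (y + 2) * x" for x y :: real by (simp add: algebra_simps)
      then show ?thesis .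
    qed
    \<comment> \<open>One \<open>?D\<close> for the header, one for rounding up the group size, and
      \<open>?q\<close> for the entries; \<open>?q\<close> is at least 1.\<close>
    also have "\<dots> \<le> (3 * ?q) * ?D"
      using q \<open>?F \<ge> 0\<close> assms(1) by (intro mult_right_mono mult_nonneg_nonneg add_nonneg_nonneg) auto
    finally show ?thesis by (simp add: mult_ac)
  qed
  have "ereal_of_enat (MF_complexity k n \<alpha> fmax r) \<le>
    ereal_of_enat (scheme_complexity (F_st_class k n \<alpha> fmax) MF ?A)"
    unfolding MF_complexity_def verification_complexity_MCAST_def ereal_of_enat_le_iff
    using pls in_MCAST_mf_pls[OF r(1)] by (intro INF_lower) simp
  also have "\<dots> \<le> ereal ?X"
  proof (rule scheme_complexity_le)
    fix G v u
    assume G: "G \<in> F_st_class k n \<alpha> fmax" "MF G" "v \<in> nodes G" "u \<in> neighbors G v"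
    then have "real (length (message ?A G (prover ?A G) v u)) \<le> bound G fmax"
      using L[of G] fmax unfolding good_def by (auto simp: F_st_class_def)
    also have "\<dots> \<le> ?X" using le G(1) by (simp add: bound_def F_st_class_def)
    finally show "real (length (message ?A G (prover ?A G) v u)) \<le> ?X" .
  qed (use F1 assms(1) in auto)
  finally show ?thesis .
qed


section \<open>The lower bound\<close>

text \<open>The star connects the remaining nodes, among them source and sink. Its centre
  \<open>m\<close> is on the right side, so none of its edges crosses the cut at
  \<open>{..<m}\<close>.\<close>

definition base_edges :: "nat \<Rightarrow> nat \<Rightarrow> nat set set" where
  "base_edges m n = {{u, w} | u w. u < m \<and> m \<le> w \<and> w < 2 * m} \<union> {{m, w} | w. 2 * m \<le> w \<and> w < n}"

lemma base_edges_subset: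
  assumes "2 * m + 2 \<le> n" "m \<ge> 1"
  shows "base_edges m n \<subseteq> complete_edges {..<n}"
proof
  fix e assume "e \<in> base_edges m n"
  then consider u w where "e = {u, w}" "u < m" "m \<le> w" "w < 2 * m"
    | w where "e = {m, w}" "2 * m \<le> w" "w < n" unfolding base_edges_def by blast
  then show "e \<in> complete_edges {..<n}"
    by cases (use assms in \<open>auto simp: complete_edges_def\<close>)
qed

text \<open>The base graph has arboricity at most \<open>m\<close>, because the right side covers
  its edges; edges inside \<open>X\<close> are then added until the value is \<open>a\<close>.
  Either \<open>X\<close> has just \<open>2 * m\<close> nodes or \<open>n\<close> is at most
  \<open>2 * m + 3\<close>, so few nodes see the cut.\<close>

lemma ex_graph_arboricity:
  assumes m: "m \<ge> 1" "2 * m + 2 \<le> n" "m \<le> a"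
    and "m = a \<or> n \<le> 2 * m + 3 \<and> a \<le> edge_arboricity (complete_edges {..<n})"
  obtains E where "base_edges m n \<subseteq> E" "E \<subseteq> complete_edges {..<n}" "edge_arboricity E = a"
    "\<And>u w. {u, w} \<in> E \<Longrightarrow> u < m \<Longrightarrow> w < 2 * m + 3"
proof -
  define X where "X = (if m = a then {..<2 * m} else {..<n})"
  have K: "complete_edges X \<subseteq> complete_edges {..<n}" using m by (auto simp: X_def complete_edges_def)
  have "edge_arboricity (base_edges m n) \<le> card {m..<2 * m}"
  proof (rule edge_arboricity_le_card)
    fix e assume "e \<in> base_edges m n"
    then obtain w where "w \<in> e" "w \<in> {m..<2 * m}" using m(1) unfolding base_edges_def by fastforce
    then show "e \<inter> {m..<2 * m} \<noteq> {}" by blast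
  qed simp
  then have low: "edge_arboricity (base_edges m n) \<le> a" using m by simp
  note base = base_edges_subset[OF m(2,1)]
  have fin: "finite (complete_edges {..<n})" by (simp add: finite_complete_edges)
  have "a \<le> edge_arboricity (complete_edges X)"
    using assms(4) le_edge_arboricity_complete[of "{..<2 * m}" m] by (auto simp: X_def)
  also have "\<dots> \<le> edge_arboricity (base_edges m n \<union> complete_edges X)"
    using base K fin complete_edges_nonempty by (intro edge_arboricity_mono) (auto intro: finite_subset)
  finally have high: "a \<le> edge_arboricity (base_edges m n \<union> complete_edges X)" .
  have "\<exists>D'\<subseteq>complete_edges X. edge_arboricity (base_edges m n \<union> D') = a"
    using base K fin complete_edges_nonempty low high
    by (intro edge_arboricity_intermediate) (auto intro: finite_subset)
  then obtain D' where D: "D' \<subseteq> complete_edges X" "edge_arboricity (base_edges m n \<union> D') = a" by blast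
  show ?thesis
  proof (rule that[of "base_edges m n \<union> D'"])
    show "base_edges m n \<union> D' \<subseteq> complete_edges {..<n}" using base K D(1) by blast
    fix u w assume e: "{u, w} \<in> base_edges m n \<union> D'" and u: "u < m"
    show "w < 2 * m + 3"
    proof (cases "{u, w} \<in> D'")
      case True
      then have "w \<in> X" using D(1) by (auto simp: complete_edges_def)
      then show ?thesis using assms(4) by (auto simp: X_def split: if_splits)
    next
      case False
      then show ?thesis using e u by (auto simp: base_edges_def doubleton_eq_iff)
    qed
  qed (use D in auto)
qed

section \<open>Circulations on the complete bipartite graph\<close>

text \<open>
  The circulations on the complete bipartite graph between \<open>{..<m}\<close> and \<open>{m..<2 * m}\<close>: all row and
  column sums of the mixed differences of \<open>x\<close> telescope to \<open>0\<close> when \<open>x\<close> vanishes on the border,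
  and \<open>x\<close> is recovered from them by summation. So there are \<open>(m - 1)\<^sup>2\<close> free values, while
  the flow on an edge stays below twice the largest of them.
\<close>

definition mixed_diff :: "(nat \<times> nat \<Rightarrow> nat) \<Rightarrow> nat \<Rightarrow> nat \<Rightarrow> int" where
  "mixed_diff x i j = int (x (i, j)) - int (x (Suc i, j)) - int (x (i, Suc j)) + int (x (Suc i, Suc j))"

lemma sum_mixed_diff_snd:
  "(\<Sum>j<m. mixed_diff x i j) = int (x (i, 0)) - int (x (Suc i, 0)) - int (x (i, m)) + int (x (Suc i, m))"
  by (induction m) (auto simp: mixed_diff_def)

lemma sum_mixed_diff_fst:
  "(\<Sum>i<m. mixed_diff x i j) = int (x (0, j)) - int (x (0, Suc j)) - int (x (m, j)) + int (x (m, Suc j))"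
  by (induction m) (auto simp: mixed_diff_def)

lemma sum_mixed_diff:
  "(\<Sum>i<a. \<Sum>j<b. mixed_diff x i j) = int (x (0, 0)) - int (x (a, 0)) - int (x (0, b)) + int (x (a, b))"
  by (induction a) (auto simp: sum_mixed_diff_snd)

lemma abs_mixed_diff_le:
  assumes "\<And>i j. x (i, j) \<le> B"
  shows "\<bar>mixed_diff x i j\<bar> \<le> 2 * int B"
  using assms[of i j] assms[of "Suc i" j] assms[of i "Suc j"] assms[of "Suc i" "Suc j"]
  unfolding mixed_diff_def by linarith

text \<open>The zeros at indices 0 and from \<open>m\<close> on are the border on which the
  telescoped sums are evaluated.\<close>

definition grid_values :: "nat \<Rightarrow> nat \<Rightarrow> (nat \<times> nat \<Rightarrow> nat) set" where
  "grid_values m B = {x. (\<forall>p. x p \<le> B) \<and> (\<forall>p. p \<notin> {1..<m} \<times> {1..<m} \<longrightarrow> x p = 0)}"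

lemma grid_values_border:
  "x \<in> grid_values m B \<Longrightarrow> i = 0 \<or> m \<le> i \<or> j = 0 \<or> m \<le> j \<Longrightarrow> x (i, j) = 0"
  by (auto simp: grid_values_def)

lemma card_grid_values: "card (grid_values m B) = (B + 1) ^ ((m - 1) ^ 2)"
proof -
  let ?I = "{1..<m} \<times> {1..<m}"
  have "bij_betw (\<lambda>x. restrict x ?I) (grid_values m B) (?I \<rightarrow>\<^sub>E {..B})"
  proof (rule bij_betw_byWitness[where f' = "\<lambda>y p. if p \<in> ?I then y p else 0"])
    show "\<forall>x\<in>grid_values m B. (\<lambda>p. if p \<in> ?I then restrict x ?I p else 0) = x"
      by (auto simp: grid_values_def restrict_def fun_eq_iff)
    show "\<forall>y\<in>?I \<rightarrow>\<^sub>E {..B}. restrict (\<lambda>p. if p \<in> ?I then y p else 0) ?I = y"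
      by (auto simp: restrict_def PiE_def extensional_def fun_eq_iff)
    show "(\<lambda>x. restrict x ?I) ` grid_values m B \<subseteq> ?I \<rightarrow>\<^sub>E {..B}"
      by (intro image_subsetI restrict_PiE_iff[THEN iffD2]) (simp add: grid_values_def)
    show "(\<lambda>y p. if p \<in> ?I then y p else 0) ` (?I \<rightarrow>\<^sub>E {..B}) \<subseteq> grid_values m B"
      by (auto simp: grid_values_def PiE_def Pi_def)
  qed
  then have "card (grid_values m B) = card (?I \<rightarrow>\<^sub>E {..B})" by (rule bij_betw_same_card)
  also have "\<dots> = (B + 1) ^ ((m - 1) ^ 2)" by (simp add: card_PiE card_cartesian_product power2_eq_square)
  finally show ?thesis .
qed

lemma mixed_diff_inj:
  assumes "x \<in> grid_values m B" "y \<in> grid_values m B"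
    and "\<And>i j. i < m \<Longrightarrow> j < m \<Longrightarrow> mixed_diff x i j = mixed_diff y i j"
  shows "x = y"
proof
  fix p :: "nat \<times> nat"
  obtain a b where p: "p = (a, b)" by (cases p)
  show "x p = y p"
  proof (cases "a < m \<and> b < m")
    case True
    then have "(\<Sum>i<a. \<Sum>j<b. mixed_diff x i j) = (\<Sum>i<a. \<Sum>j<b. mixed_diff y i j)"
      using assms(3) by (intro sum.cong refl) auto
    then show ?thesis
      using grid_values_border[OF assms(1)] grid_values_border[OF assms(2)] p by (simp add: sum_mixed_diff)
  next
    case False
    then show ?thesis
      using grid_values_border[OF assms(1), of a b] grid_values_border[OF assms(2), of a b] p by auto
  qed
qed

definition grid_flow :: "nat \<Rightarrow> (nat \<times> nat \<Rightarrow> nat) \<Rightarrow> nat \<Rightarrow> nat \<Rightarrow> int" where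
  "grid_flow m x v u =
     (if v < m \<and> m \<le> u \<and> u < 2 * m then mixed_diff x v (u - m)
      else if u < m \<and> m \<le> v \<and> v < 2 * m then - mixed_diff x u (v - m) else 0)"

text \<open>Capacities do not depend on the circulation, so mixing the states of two configurations
  keeps them consistent.\<close>

definition grid_capacity :: "nat \<Rightarrow> nat \<Rightarrow> nat \<Rightarrow> nat \<Rightarrow> nat" where
  "grid_capacity m c v u =
     (if v < m \<and> m \<le> u \<and> u < 2 * m \<or> u < m \<and> m \<le> v \<and> v < 2 * m then c else 0)"

definition edge_ports :: "nat set set \<Rightarrow> nat \<Rightarrow> nat list" where
  "edge_ports E v = sorted_list_of_set {u. {v, u} \<in> E}"

text \<open>The flow \<open>f\<close> is arbitrary, possibly not anti-symmetric, so that crossed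
  configurations have this form as well.\<close>

definition grid_config ::
    "nat \<Rightarrow> nat set set \<Rightarrow> nat \<Rightarrow> nat \<Rightarrow> (nat \<Rightarrow> nat \<Rightarrow> int) \<Rightarrow> flow_state configuration" where
  "grid_config n E m c f =
     \<lparr>nodes = {..<n}, edges = E, ports = edge_ports E,
      state = (\<lambda>v. \<lparr>ident = v, is_source = (v = 2 * m), is_sink = (v = 2 * m + 1),
        caps = map (grid_capacity m c v) (edge_ports E v), flows = map (f v) (edge_ports E v)\<rparr>)\<rparr>"

lemma grid_config_simps [simp]:
  "nodes (grid_config n E m c f) = {..<n}" "edges (grid_config n E m c f) = E"
  "ports (grid_config n E m c f) = edge_ports E"
  by (simp_all add: grid_config_def)

locale grid_graph =
  fixes n m :: nat and E :: "nat set set"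
  assumes size: "m \<ge> 1" "2 * m + 2 \<le> n"
    and base: "base_edges m n \<subseteq> E" and complete: "E \<subseteq> complete_edges {..<n}"
begin

lemma neighbors_grid_config: "neighbors (grid_config n E m c f) v = {u. {v, u} \<in> E}"
  by (simp add: neighbors_def)

lemma edgeD: "{v, u} \<in> E \<Longrightarrow> v < n \<and> u < n"
  using subsetD[OF complete, of "{v, u}"] by (simp add: complete_edges_def)

lemma finite_neighbors: "finite {u. {v, u} \<in> E}"
proof (rule finite_subset)
  show "{u. {v, u} \<in> E} \<subseteq> {..<n}" using edgeD by blast
qed simp

lemma edge_ports: "distinct (edge_ports E v)" "set (edge_ports E v) = {u. {v, u} \<in> E}"
  by (simp_all add: edge_ports_def finite_neighbors)

lemma grid_edge: "i < m \<Longrightarrow> m \<le> u \<Longrightarrow> u < 2 * m \<Longrightarrow> {i, u} \<in> E"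
proof -
  assume "i < m" "m \<le> u" "u < 2 * m"
  then have "{i, u} \<in> base_edges m n" unfolding base_edges_def by blast
  then show ?thesis using base by blast
qed

lemma held_flow_grid_config:
  assumes "{v, u} \<in> E"
  shows "held_flow (grid_config n E m c f) v u = f v u"
    "capacity (grid_config n E m c f) v u = grid_capacity m c v u"
proof -
  let ?p = "port_of (grid_config n E m c f) v u"
  have "?p < length (edge_ports E v)" "edge_ports E v ! ?p = u"
    using nth_port_of[of "grid_config n E m c f" v u] edge_ports[of v] assms by (simp_all add: degree_def)
  moreover have "flows (state (grid_config n E m c f) v) = map (f v) (edge_ports E v)"
    "caps (state (grid_config n E m c f) v) = map (grid_capacity m c v) (edge_ports E v)"
    by (simp_all add: grid_config_def)
  ultimately show "held_flow (grid_config n E m c f) v u = f v u"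
    "capacity (grid_config n E m c f) v u = grid_capacity m c v u"
    unfolding held_flow_def capacity_def by simp_all
qed

lemma connected_grid_config: "connected_graph (grid_config n E m c f)"
proof -
  let ?R = "{(x, y). {x, y} \<in> E}"
  have sym: "(x, y) \<in> ?R\<^sup>* \<Longrightarrow> (y, x) \<in> ?R\<^sup>*" for x y
    using sym_rtrancl[of ?R] by (auto simp: sym_def insert_commute)
  have "(v, m) \<in> ?R\<^sup>*" if v: "v < n" for v
  proof -
    consider "v < m" | "m < v" "v < 2 * m" | "2 * m \<le> v" | "v = m" by linarith
    then show ?thesis
    proof cases
      case 1
      then have "{v, m} \<in> E" using size by (intro grid_edge) auto
      then show ?thesis by auto
    next
      case 2
      then have "{v, 0} \<in> E" "{0, m} \<in> E" using size grid_edge[of 0 v] grid_edge[of 0 m] by (auto simp: insert_commute)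
      then have "(v, 0) \<in> ?R\<^sup>*" "(0, m) \<in> ?R\<^sup>*" by auto
      then show ?thesis by (rule rtrancl_trans)
    next
      case 3
      then have "{m, v} \<in> E" using base v by (auto simp: base_edges_def)
      then show ?thesis by (intro r_into_rtrancl) (simp add: insert_commute)
    qed auto
  qed
  then show ?thesis
    unfolding connected_graph_def using sym by (auto intro: rtrancl_trans)
qed

lemma grid_config_in_F_st:
  assumes "k \<ge> 1"
  shows "grid_config n E m c f \<in> F_st k"
proof -
  let ?G = "grid_config n E m c f"
  have "valid_configuration ?G"
    unfolding valid_configuration_def
    using size connected_grid_config edge_ports complete lessThan_iff[of 0 n]
    by (fastforce simp: neighbors_grid_config complete_edges_def simp del: lessThan_iff)
  moreover have "ident (state ?G v) \<le> card (nodes ?G) ^ k" if "v < n" for v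
  proof -
    have "n ^ 1 \<le> n ^ k" using assms size by (intro power_increasing) auto
    then show ?thesis using that by (simp add: grid_config_def)
  qed
  moreover have "capacity ?G v u = capacity ?G u v" if "u \<in> neighbors ?G v" for u v
  proof -
    have "{v, u} \<in> E" "{u, v} \<in> E" using that by (auto simp: neighbors_grid_config insert_commute)
    then show ?thesis by (simp add: held_flow_grid_config) (auto simp: grid_capacity_def)
  qed
  moreover have "\<exists>s\<in>nodes ?G. \<exists>t\<in>nodes ?G. s \<noteq> t \<and>
    (\<forall>v\<in>nodes ?G. (is_source (state ?G v) \<longleftrightarrow> v = s) \<and> (is_sink (state ?G v) \<longleftrightarrow> v = t))"
    using size by (intro bexI[of _ "2 * m"] bexI[of _ "2 * m + 1"]) (auto simp: grid_config_def)
  moreover have "inj_on (\<lambda>v. ident (state ?G v)) (nodes ?G)" by (simp add: grid_config_def inj_on_def)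
  moreover have "length (caps (state ?G v)) = degree ?G v" "length (flows (state ?G v)) = degree ?G v" for v
    by (simp_all add: grid_config_def degree_def)
  ultimately show ?thesis unfolding F_st_def by auto
qed

text \<open>All edges at the source \<open>2 * m\<close> have capacity 0. The source alone is thus a
  saturated cut, and every circulation within the capacities is maximum.\<close>

lemma MF_grid_flow:
  assumes x: "x \<in> grid_values m B" and B: "2 * B \<le> c"
  shows "MF (grid_config n E m c (grid_flow m x))" "\<bar>grid_flow m x v u\<bar> \<le> int c"
proof -
  let ?G = "grid_config n E m c (grid_flow m x)"
  have "\<bar>mixed_diff x i j\<bar> \<le> int c" for i j
    using abs_mixed_diff_le[of x B i j] x B by (auto simp: grid_values_def)
  then have abs: "\<bar>grid_flow m x v u\<bar> \<le> int (grid_capacity m c v u)" for v u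
    by (simp add: grid_flow_def grid_capacity_def)
  also have "int (grid_capacity m c v u) \<le> int c" for v u by (simp add: grid_capacity_def)
  finally show "\<bar>grid_flow m x v u\<bar> \<le> int c" for v u .
  have sum0: "(\<Sum>u | {v, u} \<in> E. grid_flow m x v u) = 0" for v
  proof -
    have reindex: "(\<Sum>u = m..<2 * m. g (u - m)) = (\<Sum>j<m. g j)" for g :: "nat \<Rightarrow> int"
      using sum.shift_bounds_nat_ivl[of "\<lambda>u. g (u - m)" 0 m m] by (simp add: atLeast0LessThan mult_2)
    consider "v < m" | "m \<le> v" "v < 2 * m" | "2 * m \<le> v" by linarith
    then show ?thesis
    proof cases
      case 1
      have "(\<Sum>u | {v, u} \<in> E. grid_flow m x v u) = (\<Sum>u = m..<2 * m. mixed_diff x v (u - m))"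
        using 1 grid_edge finite_neighbors
        by (intro sum.mono_neutral_cong_right) (auto simp: grid_flow_def)
      then show ?thesis
        using grid_values_border[OF x] by (simp add: reindex sum_mixed_diff_snd)
    next
      case 2
      have "(\<Sum>u | {v, u} \<in> E. grid_flow m x v u) = (\<Sum>u<m. - mixed_diff x u (v - m))"
        using 2 grid_edge[of _ v] finite_neighbors[of v]
        by (intro sum.mono_neutral_cong_right) (auto simp: grid_flow_def insert_commute[of v])
      then show ?thesis
        using grid_values_border[OF x] by (simp add: sum_negf sum_mixed_diff_fst)
    next
      case 3
      then show ?thesis by (intro sum.neutral) (auto simp: grid_flow_def)
    qed
  qed
  have hf: "held_flow ?G v u = grid_flow m x v u" "capacity ?G v u = grid_capacity m c v u"
    if "u \<in> neighbors ?G v" for v u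
    using that held_flow_grid_config by (auto simp: neighbors_grid_config)
  have G: "?G \<in> F_st 1" by (rule grid_config_in_F_st) simp
  have "legal_flow ?G (\<lambda>v u. real_of_int (held_flow ?G v u))"
    unfolding legal_flow_def
  proof (intro conjI ballI impI)
    fix v u assume u: "u \<in> neighbors ?G v"
    then have v: "v \<in> neighbors ?G u" using F_st_neighbors(4)[OF G] by blast
    show "real_of_int (held_flow ?G v u) = - real_of_int (held_flow ?G u v)"
      unfolding hf[OF u] hf[OF v] by (auto simp: grid_flow_def)
    show "\<bar>real_of_int (held_flow ?G v u)\<bar> \<le> real (capacity ?G v u)"
      unfolding hf[OF u] using abs[of v u] by linarith
  next
    fix v
    have "(\<Sum>u\<in>neighbors ?G v. held_flow ?G v u) = (\<Sum>u | {v, u} \<in> E. grid_flow m x v u)"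
      using hf by (intro sum.cong) (auto simp: neighbors_grid_config)
    then show "(\<Sum>u\<in>neighbors ?G v. real_of_int (held_flow ?G v u)) = 0"
      using sum0 by (simp flip: of_int_sum)
  qed
  moreover have "source_node ?G = 2 * m"
    unfolding source_node_def using size by (intro the_equality) (auto simp: grid_config_def)
  moreover have "\<not> is_sink (state ?G (2 * m))" by (simp add: grid_config_def)
  moreover have "real_of_int (held_flow ?G (2 * m) u) = real (capacity ?G (2 * m) u)"
    if "u \<in> neighbors ?G (2 * m)" for u
    unfolding hf[OF that] by (simp add: grid_flow_def grid_capacity_def)
  ultimately show "MF ?G"
    unfolding MF_def using size by (intro saturated_cut_imp_maximum_flow[OF G, where S = "{2 * m}"]) auto
qed

end

section \<open>Counting messages across the cut\<close>

lemma card_few_values: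
  assumes "finite S" "s0 \<in> S" "finite Y"
  shows "finite {g \<in> Y \<rightarrow>\<^sub>E S. card (g ` Y) \<le> r}"
    "card {g \<in> Y \<rightarrow>\<^sub>E S. card (g ` Y) \<le> r} \<le> card S ^ r * r ^ card Y"
proof -
  let ?P = "({..<r} \<rightarrow>\<^sub>E S) \<times> (Y \<rightarrow>\<^sub>E {..<r})"
  let ?\<phi> = "\<lambda>(t, h). restrict (t \<circ> h) Y"
  show "finite {g \<in> Y \<rightarrow>\<^sub>E S. card (g ` Y) \<le> r}"
    using assms by (intro finite_subset[OF _ finite_PiE[of Y "\<lambda>_. S"]]) auto
  have "{g \<in> Y \<rightarrow>\<^sub>E S. card (g ` Y) \<le> r} \<subseteq> ?\<phi> ` ?P"
  proof
    fix g assume "g \<in> {g \<in> Y \<rightarrow>\<^sub>E S. card (g ` Y) \<le> r}"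
    then have g: "g \<in> Y \<rightarrow>\<^sub>E S" "card (g ` Y) \<le> card {..<r}" by auto
    obtain e where e: "e ` (g ` Y) \<subseteq> {..<r}" "inj_on e (g ` Y)"
      using card_le_inj[of "g ` Y" "{..<r}"] assms(3) g(2) by auto
    define t where "t = restrict (\<lambda>i. if i \<in> e ` (g ` Y) then the_inv_into (g ` Y) e i else s0) {..<r}"
    define h where "h = restrict (e \<circ> g) Y"
    have "the_inv_into (g ` Y) e i \<in> S" if "i \<in> e ` (g ` Y)" for i
      using the_inv_into_into[OF e(2) that subset_refl] g(1) by auto
    then have "t \<in> {..<r} \<rightarrow>\<^sub>E S" using assms(2) by (auto simp: t_def)
    moreover have "h \<in> Y \<rightarrow>\<^sub>E {..<r}" using e(1) by (auto simp: h_def image_subset_iff)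
    moreover have "restrict (t \<circ> h) Y = g"
    proof
      fix y
      show "restrict (t \<circ> h) Y y = g y"
      proof (cases "y \<in> Y")
        case True
        then have "e (g y) < r" using e(1) by (simp add: image_subset_iff)
        then show ?thesis using True the_inv_into_f_f[OF e(2), of "g y"] by (simp add: t_def h_def)
      next
        case False
        then show ?thesis using g(1) by (simp add: PiE_def extensional_def)
      qed
    qed
    ultimately show "g \<in> ?\<phi> ` ?P" by (intro image_eqI[of _ _ "(t, h)"]) auto
  qed
  moreover have "finite ?P" using assms by (intro finite_cartesian_product finite_PiE) auto
  ultimately have "card {g \<in> Y \<rightarrow>\<^sub>E S. card (g ` Y) \<le> r} \<le> card ?P"
    by (rule surj_card_le[rotated])
  then show "card {g \<in> Y \<rightarrow>\<^sub>E S. card (g ` Y) \<le> r} \<le> card S ^ r * r ^ card Y"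
    using assms by (simp add: card_cartesian_product card_PiE)
qed

lemma card_short_bits: "finite {w :: bits. length w \<le> M}" "card {w :: bits. length w \<le> M} \<le> 2 ^ (M + 1)"
proof -
  have "finite {w :: bits. set w \<subseteq> UNIV \<and> length w \<le> M}"
    by (rule finite_lists_length_le) simp
  then show "finite {w :: bits. length w \<le> M}" by simp
  have "card {w :: bits. length w \<le> M} = (\<Sum>i\<le>M. 2 ^ i)"
    using card_lists_length_le[of "UNIV :: bool set" M] by simp
  also have "\<dots> < 2 ^ (M + 1)" by (induction M) auto
  finally show "card {w :: bits. length w \<le> M} \<le> 2 ^ (M + 1)" by simp
qed

context grid_graph
begin

text \<open>
  If two of the flows induce the same messages across the cut between \<open>{..<m}\<close> and the other nodes,
  then each side accepts in the configuration that takes the states and the labels of the former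
  nodes from the first and those of the latter from the second; its flow is not anti-symmetric.
\<close>

lemma grid_counting_bound:
  assumes cross: "\<And>u w. {u, w} \<in> E \<Longrightarrow> u < m \<Longrightarrow> w < 2 * m + 3"
    and k: "k \<ge> 1" and A: "is_pls (F_st k) MF A" "in_MCAST r (F_st k) A"
    and M: "scheme_complexity (F_st_class k n (edge_arboricity E) fmax) MF A \<le> enat M"
    and B: "2 * B \<le> fmax" and r: "r \<ge> 1"
  shows "(B + 1) ^ ((m - 1) ^ 2) \<le> ((2 ^ (M + 1)) ^ r * r ^ (m + 3)) ^ (2 * m + 3)"
proof (rule ccontr)
  assume less: "\<not> ?thesis"
  define G where "G x = grid_config n E m fmax (grid_flow m x)" for x
  define L where "L x = prover A (G x)" for x
  define Y where "Y a = {b. {a, b} \<in> E \<and> (a < m) \<noteq> (b < m)}" for a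
  define W where "W = {w :: bits. length w \<le> M}"
  \<comment> \<open>All messages across the cut, in both directions.\<close>
  define T where "T x = restrict (\<lambda>a. restrict (message A (G x) (L x) a) (Y a)) {..<2 * m + 3}" for x
  define Z where "Z a = {g \<in> Y a \<rightarrow>\<^sub>E W. card (g ` Y a) \<le> r}" for a
  have G: "G x \<in> F_st k" for x unfolding G_def by (rule grid_config_in_F_st[OF k])
  have legal: "MF (G x)" if "x \<in> grid_values m B" for x
    unfolding G_def by (rule MF_grid_flow(1)[OF that B])
  have G_class: "G x \<in> F_st_class k n (edge_arboricity E) fmax" if x: "x \<in> grid_values m B" for x
    using G[of x] MF_grid_flow(2)[OF x B] held_flow_grid_config
    by (auto simp: F_st_class_def arboricity_eq_edge_arboricity G_def neighbors_grid_config)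
  have nb: "neighbors (G x) a = {b. {a, b} \<in> E}" for x a by (simp add: G_def neighbors_grid_config)
  have short: "length (message A (G x) (L x) a b) \<le> M"
    if "x \<in> grid_values m B" "{a, b} \<in> E" for x a b
  proof -
    have "enat (length (message A (G x) (L x) a b)) \<le>
      scheme_complexity (F_st_class k n (edge_arboricity E) fmax) MF A"
      unfolding scheme_complexity_def L_def
      using G_class[OF that(1)] legal[OF that(1)] that(2) edgeD[OF that(2)] nb
      by (intro Sup_upper CollectI exI[of _ "G x"] exI[of _ a] exI[of _ b]) (auto simp: G_def)
    also note M
    finally show ?thesis by simp
  qed
  have finY: "finite (Y a)" and cardY: "card (Y a) \<le> m + 3" for a
  proof -
    \<comment> \<open>A left node has at most \<open>m + 3\<close> neighbors beyond the cut by the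
      assumption \<open>cross\<close>, a right node at most \<open>m\<close>.\<close>
    have "Y a \<subseteq> {m..<2 * m + 3}" if "a < m" using that cross by (auto simp: Y_def)
    moreover have "Y a \<subseteq> {..<m}" if "\<not> a < m" using that by (auto simp: Y_def)
    ultimately show "finite (Y a)" "card (Y a) \<le> m + 3"
      using card_mono[of "{m..<2 * m + 3}" "Y a"] card_mono[of "{..<m}" "Y a"]
      by (cases "a < m"; auto intro: finite_subset)+
  qed
  have Z: "finite (Z a)" "card (Z a) \<le> (2 ^ (M + 1)) ^ r * r ^ (m + 3)" for a
  proof -
    note few = card_few_values[of W "[]" "Y a" r, OF _ _ finY]
    show "finite (Z a)" using few(1) card_short_bits(1) by (simp add: Z_def W_def)
    have "card (Z a) \<le> card W ^ r * r ^ card (Y a)"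
      using few(2) card_short_bits(1) by (simp add: Z_def W_def)
    also have "\<dots> \<le> (2 ^ (M + 1)) ^ r * r ^ (m + 3)"
      using card_short_bits(2)[of M] cardY r by (intro mult_mono power_mono power_increasing) (auto simp: W_def)
    finally show "card (Z a) \<le> (2 ^ (M + 1)) ^ r * r ^ (m + 3)" .
  qed
  have T: "T x \<in> PiE {..<2 * m + 3} Z" if x: "x \<in> grid_values m B" for x
    unfolding T_def
  proof (rule restrict_PiE_iff[THEN iffD2], intro ballI)
    fix a assume "a \<in> {..<2 * m + 3}"
    let ?g = "restrict (message A (G x) (L x) a) (Y a)"
    have "card (?g ` Y a) \<le> r"
    proof (cases "a < n")
      case True
      have "?g ` Y a \<subseteq> send A (state (G x) a) (L x a) ` {..<degree (G x) a}"
        using F_st_port_of(1)[OF G[of x]] by (auto simp: message_def Y_def nb)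
      then have "card (?g ` Y a) \<le> card (send A (state (G x) a) (L x a) ` {..<degree (G x) a})"
        by (intro card_mono) auto
      also have "\<dots> \<le> r" using A(2) G[of x] True unfolding in_MCAST_def by (auto simp: G_def)
      finally show ?thesis .
    next
      \<comment> \<open>\<open>n\<close> may be \<open>2 * m + 2\<close>, in which case the last
        index is not a node.\<close>
      case False
      then have "Y a = {}" using edgeD by (auto simp: Y_def)
      then show ?thesis by simp
    qed
    moreover have "?g \<in> Y a \<rightarrow>\<^sub>E W" using short[OF x] by (auto simp: Y_def W_def)
    ultimately show "?g \<in> Z a" by (simp add: Z_def)
  qed
  have "card (PiE {..<2 * m + 3} Z) = (\<Prod>a<2 * m + 3. card (Z a))" by (simp add: card_PiE)
  also have "\<dots> \<le> (\<Prod>a<2 * m + 3. (2 ^ (M + 1)) ^ r * r ^ (m + 3))" by (intro prod_mono) (use Z in auto)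
  also have "\<dots> < card (grid_values m B)" using less by (simp add: card_grid_values)
  finally have "card (PiE {..<2 * m + 3} Z) < card (grid_values m B)" .
  moreover have "card (T ` grid_values m B) \<le> card (PiE {..<2 * m + 3} Z)"
    using T Z(1) by (intro card_mono finite_PiE) auto
  ultimately have "card (T ` grid_values m B) \<noteq> card (grid_values m B)" by linarith
  then have "\<not> inj_on T (grid_values m B)" using card_image by blast
  then obtain x y where xy: "x \<in> grid_values m B" "y \<in> grid_values m B" "x \<noteq> y" "T x = T y"
    unfolding inj_on_def by blast
  have same: "message A (G x) (L x) a b = message A (G y) (L y) a b" if "{a, b} \<in> E" "(a < m) \<noteq> (b < m)" for a b
  proof -
    have "{b, a} \<in> E" using that(1) by (simp add: insert_commute)
    then have "a < 2 * m + 3" "b \<in> Y a" using that cross[of b a] by (auto simp: Y_def)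
    then have "T z a b = message A (G z) (L z) a b" for z by (simp add: T_def)
    then show ?thesis using fun_cong[OF fun_cong[OF xy(4)], of a b] by simp
  qed
  \<comment> \<open>All these configurations share graph, ports and identifiers, so every node sees
    exactly what it sees in one of the two legal ones.\<close>
  define H where "H = grid_config n E m fmax (\<lambda>v. if v < m then grid_flow m x v else grid_flow m y v)"
  define l where "l v = (if v < m then L x v else L y v)" for v
  have H: "H \<in> F_st k" unfolding H_def by (rule grid_config_in_F_st[OF k])
  have st: "state H v = (if v < m then state (G x) v else state (G y) v)" for v
    by (simp add: H_def G_def grid_config_def)
  have port: "port_of H = port_of (G x)" "port_of (G y) = port_of (G x)" "ports H = edge_ports E" "ports (G z) = edge_ports E" for z
    by (simp_all add: port_of_def degree_def H_def G_def fun_eq_iff)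
  have msg: "message A H l u v = (if u < m then message A (G x) (L x) u v else message A (G y) (L y) u v)" for u v
    by (simp add: message_def st port l_def)
  have acc: "accepted A (G z) (L z)" if "z \<in> grid_values m B" for z
    using A(1) G[of z] legal[OF that] unfolding is_pls_def L_def by blast
  have "accepted A H l"
    unfolding accepted_def
  proof
    fix v assume "v \<in> nodes H"
    then have v: "v \<in> nodes (G x)" "v \<in> nodes (G y)" by (simp_all add: H_def G_def)
    define z where "z = (if v < m then x else y)"
    have "map (\<lambda>u. message A H l u v) (ports H v) = map (\<lambda>u. message A (G z) (L z) u v) (ports (G z) v)"
      unfolding port
    proof (intro map_cong refl)
      fix u assume "u \<in> set (edge_ports E v)"
      then have "{u, v} \<in> E" by (simp add: edge_ports insert_commute)
      then show "message A H l u v = message A (G z) (L z) u v"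
        using same[of u v] by (auto simp: msg z_def)
    qed
    moreover have "decide A (state (G z) v) (L z v) (map (\<lambda>u. message A (G z) (L z) u v) (ports (G z) v))"
      using acc[of z] xy v unfolding accepted_def z_def by auto
    ultimately show "decide A (state H v) (l v) (map (\<lambda>u. message A H l u v) (ports H v))"
      by (auto simp: st l_def z_def)
  qed
  moreover have "\<not> MF H"
  proof
    assume "MF H"
    \<comment> \<open>The left end of the edge holds the value of \<open>x\<close>, the right end
      the negated value of \<open>y\<close>.\<close>
    have "mixed_diff x i j = mixed_diff y i j" if "i < m" "j < m" for i j
    proof -
      have e: "{i, m + j} \<in> E" "{m + j, i} \<in> E" using grid_edge[of i "m + j"] that by (auto simp: insert_commute)
      then have "m + j \<in> neighbors H i" "i \<in> nodes H"
        using edgeD by (auto simp: H_def neighbors_grid_config)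
      then have "real_of_int (held_flow H i (m + j)) = - real_of_int (held_flow H (m + j) i)"
        using \<open>MF H\<close> unfolding MF_def maximum_flow_def legal_flow_def by blast
      then have "held_flow H i (m + j) = - held_flow H (m + j) i" by linarith
      then show ?thesis
        using that unfolding H_def held_flow_grid_config[OF e(1)] held_flow_grid_config[OF e(2)]
        by (simp add: grid_flow_def)
    qed
    then show False using mixed_diff_inj[OF xy(1,2)] xy(3) by blast
  qed
  ultimately show False using A(1) H unfolding is_pls_def by blast
qed

end


section \<open>Constants of the lower bound\<close>

text \<open>Taking logarithms leaves about \<open>m\<^sup>2 * ?F\<close> on the left and
  \<open>2 * m * r * M\<close> plus half of \<open>m\<^sup>2 * ?F\<close> on the right. The bounds
  98 and 20 keep the rounding losses small enough for a positive multiple of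
  \<open>m\<^sup>2 * ?F\<close> to remain.\<close>

lemma message_length_bound:
  fixes \<alpha> m r M fmax :: nat
  assumes count: "(fmax div 2 + 1) ^ ((m - 1) ^ 2) \<le> ((2 ^ (M + 1)) ^ r * r ^ (m + 3)) ^ (2 * m + 3)"
    and m: "m \<ge> 98" "\<alpha> \<le> 4 * m" and r: "1 \<le> r" "200 * r \<le> \<alpha>" "r ^ 4 \<le> fmax"
    and F: "log 2 (real fmax) \<ge> 20"
  shows "1 / 50 * (real \<alpha> / real r * log 2 (real fmax)) \<le> real M"
proof -
  let ?F = "log 2 (real fmax)" and ?b = "fmax div 2 + 1"
  define \<mu> where "\<mu> = real m"
  have \<mu>: "\<mu> \<ge> 98" using m(1) by (simp add: \<mu>_def)
  have fmax: "real fmax > 0" using F by (cases "fmax = 0") (auto simp: log_def)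
  have "?F - 1 = log 2 (real fmax / 2)" using fmax by (simp add: log_divide)
  also have "\<dots> \<le> log 2 (real ?b)" using fmax by (intro log_mono) linarith+
  finally have b: "?F - 1 \<le> log 2 (real ?b)" .
  have "4 * log 2 (real r) = log 2 (real (r ^ 4))" using r(1) by (simp add: log_nat_power)
  also have "\<dots> \<le> ?F" using r(1,3) by (intro log_mono) (auto simp flip: of_nat_power)
  \<comment> \<open>The fourth power makes the choice of groups cost
    \<open>2 * m\<^sup>2 * ?F / 4\<close> up to lower order terms.\<close>
  finally have logr: "log 2 (real r) \<le> ?F / 4" by simp
  have "log 2 (real (?b ^ ((m - 1) ^ 2))) \<le> log 2 (real (((2 ^ (M + 1)) ^ r * r ^ (m + 3)) ^ (2 * m + 3)))"
    using count by (intro log_mono) (auto simp del: of_nat_power of_nat_mult)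
  also have "\<dots> = real (2 * m + 3) * (real r * real (M + 1) + real (m + 3) * log 2 (real r))"
    using r(1) by (simp add: log_nat_power log_mult algebra_simps)
  also have "\<dots> \<le> real (2 * m + 3) * (real r * real (M + 1) + real (m + 3) * (?F / 4))"
    using logr by (intro mult_left_mono add_left_mono) auto
  finally have "real ((m - 1) ^ 2) * log 2 (real ?b) \<le> real (2 * m + 3) * (real r * real (M + 1) + real (m + 3) * (?F / 4))"
    by (simp add: log_nat_power)
  moreover have "real ((m - 1) ^ 2) * (?F - 1) \<le> real ((m - 1) ^ 2) * log 2 (real ?b)"
    using b by (intro mult_left_mono) auto
  moreover have "real ((m - 1) ^ 2) = (\<mu> - 1)\<^sup>2" using m(1) by (simp add: \<mu>_def of_nat_diff)
  ultimately have main: "(\<mu> - 1)\<^sup>2 * (?F - 1) \<le> (2 * \<mu> + 3) * (real r * real (M + 1) + (\<mu> + 3) * (?F / 4))"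
    by (simp add: \<mu>_def)
  have "(97 / 98 * \<mu>) * (97 / 98 * \<mu>) \<le> (\<mu> - 1) * (\<mu> - 1)" using \<mu> by (intro mult_mono) auto
  moreover have "0 \<le> \<mu> * \<mu>" by simp
  ultimately have sq: "97 / 100 * (\<mu> * \<mu>) \<le> (\<mu> - 1)\<^sup>2" unfolding power2_eq_square by linarith
  have "(97 / 100 * (\<mu> * \<mu>)) * (19 / 20 * ?F) \<le> (\<mu> - 1)\<^sup>2 * (?F - 1)"
    using sq F \<mu> by (intro mult_mono) auto
  also note main
  also have "(2 * \<mu> + 3) * (real r * real (M + 1) + (\<mu> + 3) * (?F / 4))
    \<le> (41 / 20 * \<mu>) * (real r * real (M + 1) + (21 / 20 * \<mu>) * (?F / 4))"
    using \<mu> F by (intro mult_mono add_left_mono mult_right_mono) auto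
  finally have "\<mu> * (97 / 100 * (19 / 20) * \<mu> * ?F) \<le> \<mu> * (41 / 20 * (real r * real (M + 1) + 21 / 80 * \<mu> * ?F))"
    by (simp add: algebra_simps)
  then have "97 / 100 * (19 / 20) * \<mu> * ?F \<le> 41 / 20 * (real r * real (M + 1) + 21 / 80 * \<mu> * ?F)"
    using \<mu> by simp
  moreover have "\<mu> * ?F \<ge> 0" using \<mu> F by simp
  ultimately have "3 / 25 * (\<mu> * ?F) \<le> real r * real (M + 1)" by (simp add: algebra_simps)
  moreover have "real \<alpha> * ?F \<le> (4 * \<mu>) * ?F" using m(2) F by (intro mult_right_mono) (auto simp: \<mu>_def)
  ultimately have "3 / 100 * (real \<alpha> * ?F) \<le> real r * real (M + 1)" by simp
  then have M: "3 / 100 * (real \<alpha> / real r * ?F) \<le> real (M + 1)" using r(1) by (simp add: field_simps)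
  \<comment> \<open>The difference between \<open>3 / 100\<close> and \<open>1 / 50\<close> pays for
    the \<open>+ 1\<close>, because the product is at least 4000.\<close>
  have "200 \<le> real \<alpha> / real r" using r(1,2) by (simp add: field_simps flip: of_nat_mult)
  then have "200 * 20 \<le> real \<alpha> / real r * ?F" using F by (intro mult_mono) auto
  then show ?thesis using M by simp
qed

text \<open>The configuration \<open>G0\<close> shows that \<open>n\<close> and \<alpha> are
  compatible; the hard configurations with these parameters are built afresh.\<close>

lemma MF_complexity_lower:
  assumes G0: "G0 \<in> F_st_class k n \<alpha> fmax" and k: "k \<ge> 1"
    and r: "1 \<le> r" "200 * r \<le> \<alpha>" "r ^ 4 \<le> fmax" and F: "log 2 (real fmax) \<ge> 20"
  shows "ereal (1 / 50 * (real \<alpha> / real r * log 2 (real fmax))) \<le> ereal_of_enat (MF_complexity k n \<alpha> fmax r)"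
    (is "ereal ?X \<le> _")
proof -
  have G: "G0 \<in> F_st k" and n: "card (nodes G0) = n" and \<alpha>: "edge_arboricity (edges G0) = \<alpha>"
    using G0 by (auto simp: F_st_class_def arboricity_eq_edge_arboricity)
  have e: "e \<subseteq> nodes G0 \<and> card e = 2" if "e \<in> edges G0" for e
    using F_st_edges(2,3)[OF G that] by simp
  have "edge_arboricity (edges G0) \<le> card (nodes G0)"
  proof (rule edge_arboricity_le_card[OF F_st_nodes(1)[OF G]])
    fix e' assume "e' \<in> edges G0"
    from e[OF this] show "e' \<inter> nodes G0 \<noteq> {}" by (metis card.empty inf.absorb1 zero_neq_numeral)
  qed
  then have \<alpha>n: "\<alpha> \<le> n" using \<alpha> n by simp
  have \<alpha>K: "\<alpha> \<le> edge_arboricity (complete_edges {..<n})"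
    using edge_arboricity_le_complete[OF F_st_nodes(1)[OF G], of "edges G0"] e \<alpha> n by simp
  have \<alpha>200: "\<alpha> \<ge> 200" using r by linarith
  \<comment> \<open>In the second case \<open>n\<close> is \<open>2 * m + 2\<close> or
    \<open>2 * m + 3\<close>, and \<alpha> is at most \<open>n\<close>, hence at most
    \<open>4 * m\<close>.\<close>
  define m where "m = (if 2 * \<alpha> + 2 \<le> n then \<alpha> else (n - 2) div 2)"
  have m: "m \<ge> 98" "2 * m + 2 \<le> n" "m \<le> \<alpha>" "\<alpha> \<le> 4 * m" "m = \<alpha> \<or> n \<le> 2 * m + 3"
    using \<alpha>n \<alpha>200 by (auto simp: m_def)
  obtain E where E: "base_edges m n \<subseteq> E" "E \<subseteq> complete_edges {..<n}" "edge_arboricity E = \<alpha>"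
    "\<And>u w. {u, w} \<in> E \<Longrightarrow> u < m \<Longrightarrow> w < 2 * m + 3"
    by (rule ex_graph_arboricity[of m n \<alpha>]) (use m \<alpha>K in auto)
  interpret grid_graph n m E using m E by unfold_locales auto
  have "enat (nat \<lceil>?X\<rceil>) \<le> MF_complexity k n \<alpha> fmax r"
    unfolding MF_complexity_def verification_complexity_MCAST_def
  proof (rule INF_greatest)
    fix A assume A: "A \<in> {A. is_pls (F_st k) MF A \<and> in_MCAST r (F_st k) A}"
    show "enat (nat \<lceil>?X\<rceil>) \<le> scheme_complexity (F_st_class k n \<alpha> fmax) MF A"
    proof (cases "scheme_complexity (F_st_class k n \<alpha> fmax) MF A")
      case (enat M)
      have "(fmax div 2 + 1) ^ ((m - 1) ^ 2) \<le> ((2 ^ (M + 1)) ^ r * r ^ (m + 3)) ^ (2 * m + 3)"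
        by (rule grid_counting_bound[where A = A and fmax = fmax, OF E(4) k _ _ _ _ r(1)]) (use A enat E(3) in auto)
      then have "?X \<le> real M" using m r F by (intro message_length_bound) auto
      then show ?thesis using enat by (simp add: ceiling_le_iff)
    qed simp
  qed
  then have "ereal_of_enat (enat (nat \<lceil>?X\<rceil>)) \<le> ereal_of_enat (MF_complexity k n \<alpha> fmax r)"
    by (simp only: ereal_of_enat_le_iff)
  moreover have "ereal ?X \<le> ereal_of_enat (enat (nat \<lceil>?X\<rceil>))" by (simp add: real_nat_ceiling_ge)
  ultimately show ?thesis by (rule order_trans[rotated])
qed

text \<open>For parameters realised by no legal configuration the complexity would be a supremum
  over the empty set, that is 0; this explains the existential premise.\<close>

theorem theorem3:
  fixes k :: nat and \<kappa> :: real
  assumes "k \<ge> 1" and "\<kappa> > 0"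
  shows "\<exists>c>1. \<exists>C\<^sub>1>0. \<exists>C\<^sub>2>0. \<exists>N. \<forall>n \<alpha> fmax r :: nat.
           (\<exists>G\<in>F_st_class k n \<alpha> fmax. MF G) \<and>
           log 2 (real fmax) \<ge> \<kappa> * log 2 (real n) \<and>
           1 \<le> r \<and> real r \<le> min (real \<alpha> / c) (root 4 (real fmax)) \<longrightarrow>
             ereal_of_enat (MF_complexity k n \<alpha> fmax r)
               \<le> ereal (C\<^sub>2 * (real \<alpha> / real r * log 2 (real fmax))) \<and>
             (n \<ge> N \<longrightarrow>
               ereal (C\<^sub>1 * (real \<alpha> / real r * log 2 (real fmax)))
                 \<le> ereal_of_enat (MF_complexity k n \<alpha> fmax r))"
proof -
  \<comment> \<open>From \<open>?N\<close> on, \<kappa> times the logarithm of \<open>n\<close> is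
    at least 20, as the numerical estimate demands.\<close>
  let ?C\<^sub>2 = "3 * ((2 * real k + 7) / \<kappa> + 2)" and ?N = "nat \<lceil>2 powr (20 / \<kappa>)\<rceil>"
  have main: "ereal_of_enat (MF_complexity k n \<alpha> fmax r)
      \<le> ereal (?C\<^sub>2 * (real \<alpha> / real r * log 2 (real fmax))) \<and>
    (n \<ge> ?N \<longrightarrow> ereal (1 / 50 * (real \<alpha> / real r * log 2 (real fmax)))
      \<le> ereal_of_enat (MF_complexity k n \<alpha> fmax r))"
    if G: "G \<in> F_st_class k n \<alpha> fmax" and F: "log 2 (real fmax) \<ge> \<kappa> * log 2 (real n)"
      and r: "1 \<le> r" "real r \<le> min (real \<alpha> / 200) (root 4 (real fmax))" for n \<alpha> fmax r G
  proof -
    have n: "n \<ge> 2" using G F_st_card_nodes[of G k] by (auto simp: F_st_class_def)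
    have r\<alpha>: "200 * r \<le> \<alpha>" using r(2) by simp
    have "real r ^ 4 \<le> root 4 (real fmax) ^ 4" using r(2) by (intro power_mono) auto
    then have "real (r ^ 4) \<le> real fmax" by simp
    then have "r ^ 4 \<le> fmax" by (simp only: of_nat_le_iff)
    moreover have "log 2 (real fmax) \<ge> 20" if "n \<ge> ?N"
    proof -
      have "2 powr (20 / \<kappa>) \<le> real n" using that by linarith
      then have "log 2 (2 powr (20 / \<kappa>)) \<le> log 2 (real n)" by (intro log_mono) auto
      then have "20 \<le> \<kappa> * log 2 (real n)" using assms(2) by (simp add: field_simps)
      then show ?thesis using F by linarith
    qed
    ultimately show ?thesis
      using MF_complexity_upper[OF assms(2) n F r(1)] MF_complexity_lower[OF G assms(1) r(1) r\<alpha>] r\<alpha> by auto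
  qed
  have "?C\<^sub>2 > 0" using assms(2) by (intro mult_pos_pos add_nonneg_pos) auto
  then show ?thesis
    using main by (intro exI[of _ "200 :: real"] exI[of _ "1 / 50 :: real"] exI[of _ ?C\<^sub>2] exI[of _ ?N] conjI) auto
qed

end
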